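(* Let $f\in\mathcal{A}_C$ and for $x\in\mathbb{R}$, $y>0$ let $K(x,y)=\dfrac{y}{\pi(x^2+y^2)}$. Then the Poisson integral $$u(x,y)=\int_{-\infty}^\infty f(t)K(x-t,y)\,dt$$ exists for all $x\in\mathbb{R}$, $y>0$, and $u$ is harmonic in the upper half plane $\{(x,y):x\in\mathbb{R},\,y>0\}$.
   Context: $\mathcal{D}=C_c^\infty(\mathbb{R})$ (real-valued), $\mathcal{D}'$ is the space of distributions, $\langle T',\phi\rangle=-\langle T,\phi'\rangle$; functions are identified with distributions in the usual way. $\overline{\mathbb{R}}=[-\infty,\infty]$. $C^0(\overline{\mathbb{R}})$ is the set of continuous real functions $F$ on $\mathbb{R}$ with real limits at $\pm\infty$, extended by $F(\pm\infty)=\lim_{\pm\infty}F$. $\mathcal{B}_C=\{F\in C^0(\overline{\mathbb{R}}): F(-\infty)=0\}$ and $\mathcal{A}_C=\{f\in\mathcal{D}': f=F' \text{ for some } F\in\mathcal{B}_C\}$; the primitive $F\in\mathcal{B}_C$ of $f\in\mathcal{A}_C$ is unique. For $f\in\mathcal{A}_C$ with primitive $F$ and $g:\overline{\mathbb{R}}\to\mathbb{R}$ of bounded variation, $\int_{-\infty}^\infty fg=\int_{-\infty}^\infty f(t)g(t)\,dt:=F(\infty)g(\infty)-\int_{-\infty}^\infty F\,dg$ (Riemann–Stieltjes integral over $\overline{\mathbb{R}}$). A function of bounded variation on $\mathbb{R}$, such as $t\mapsto K(x-t,y)$, is extended to $\overline{\mathbb{R}}$ by its limits at $\pm\infty$.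 *)

theory Defs
  imports "HOL-Analysis.Analysis"
begin

section \<open>Test functions and distributions on the real line\<close>

definition test_functions :: "(real \<Rightarrow> real) set" where
  "test_functions =
     {\<phi>. (\<forall>n x. (deriv ^^ n) \<phi> field_differentiable (at x)) \<and> compact (closure {x. \<phi> x \<noteq> 0})}"

definition tendsto_test :: "(nat \<Rightarrow> real \<Rightarrow> real) \<Rightarrow> (real \<Rightarrow> real) \<Rightarrow> bool" where
  "tendsto_test \<Phi> \<phi> \<longleftrightarrow>
     (\<exists>K. compact K \<and> (\<forall>n. closure {x. \<Phi> n x \<noteq> 0} \<subseteq> K)) \<and>
     (\<forall>m. uniform_limit UNIV (\<lambda>n. (deriv ^^ m) (\<Phi> n)) ((deriv ^^ m) \<phi>) sequentially)"

text \<open>Functionals are extensional, i.e. \<^const>\<open>undefined\<close> outside the test functions, so that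
  equality of distributions is equality in HOL.\<close>

type_synonym functional = "(real \<Rightarrow> real) \<Rightarrow> real"

definition distributions :: "functional set" where
  "distributions =
     {T. T \<in> extensional test_functions \<and>
         (\<forall>\<phi>\<in>test_functions. \<forall>\<psi>\<in>test_functions. \<forall>a b.
            T (\<lambda>x. a * \<phi> x + b * \<psi> x) = a * T \<phi> + b * T \<psi>) \<and>
         (\<forall>\<Phi> \<phi>. (\<forall>n. \<Phi> n \<in> test_functions) \<and> \<phi> \<in> test_functions \<and> tendsto_test \<Phi> \<phi>
            \<longrightarrow> (\<lambda>n. T (\<Phi> n)) \<longlonglongrightarrow> T \<phi>)}"

definition distribution_of :: "(real \<Rightarrow> real) \<Rightarrow> functional" where
  "distribution_of h = (\<lambda>\<phi>\<in>test_functions. \<integral>x. h x * \<phi> x \<partial>lborel)"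

definition distribution_deriv :: "functional \<Rightarrow> functional" where
  "distribution_deriv T = (\<lambda>\<phi>\<in>test_functions. - T (deriv \<phi>))"

section \<open>Functions on the extended real line\<close>

definition extend :: "(real \<Rightarrow> real) \<Rightarrow> ereal \<Rightarrow> real" where
  "extend h x = (case x of ereal r \<Rightarrow> h r | PInfty \<Rightarrow> Lim at_top h | MInfty \<Rightarrow> Lim at_bot h)"

definition C0_ext :: "(ereal \<Rightarrow> real) set" where
  "C0_ext = {extend h | h. continuous_on UNIV h \<and>
               (\<exists>l. (h \<longlongrightarrow> l) at_top) \<and> (\<exists>l. (h \<longlongrightarrow> l) at_bot)}"

definition B_C :: "(ereal \<Rightarrow> real) set" where
  "B_C = {F \<in> C0_ext. F (-\<infinity>) = 0}"

definition bounded_variation :: "(ereal \<Rightarrow> real) \<Rightarrow> bool" where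
  "bounded_variation g \<longleftrightarrow>
     (\<exists>M. \<forall>n. \<forall>t :: nat \<Rightarrow> ereal. (\<forall>i<n. t i \<le> t (Suc i)) \<longrightarrow>
        (\<Sum>i<n. \<bar>g (t (Suc i)) - g (t i)\<bar>) \<le> M)"

text \<open>The Riemann--Stieltjes integral over the extended real line. As there is no canonical mesh
  on the extended line, the limit is taken along refinements of partitions
  (\<open>P\<close> is the set of points that a partition \<open>t\<close> has to contain; \<open>s\<close> are the tags).\<close>

definition has_RS_integral :: "(ereal \<Rightarrow> real) \<Rightarrow> (ereal \<Rightarrow> real) \<Rightarrow> real \<Rightarrow> bool" where
  "has_RS_integral F g I \<longleftrightarrow>
     (\<forall>\<epsilon>>0. \<exists>P. finite P \<and>
        (\<forall>n. \<forall>t s :: nat \<Rightarrow> ereal.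
           t 0 = -\<infinity> \<and> t n = \<infinity> \<and> (\<forall>i<n. t i < t (Suc i)) \<and> P \<subseteq> t ` {..n} \<and>
           (\<forall>i<n. t i \<le> s i \<and> s i \<le> t (Suc i)) \<longrightarrow>
           \<bar>(\<Sum>i<n. F (s i) * (g (t (Suc i)) - g (t i))) - I\<bar> < \<epsilon>))"

definition RS_integral :: "(ereal \<Rightarrow> real) \<Rightarrow> (ereal \<Rightarrow> real) \<Rightarrow> real" where
  "RS_integral F g = (THE I. has_RS_integral F g I)"

section \<open>The continuous primitive integral\<close>

definition is_primitive :: "(ereal \<Rightarrow> real) \<Rightarrow> functional \<Rightarrow> bool" where
  "is_primitive F f \<longleftrightarrow> F \<in> B_C \<and> f = distribution_deriv (distribution_of (\<lambda>x. F (ereal x)))"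

definition A_C :: "functional set" where
  "A_C = {f \<in> distributions. \<exists>F. is_primitive F f}"

definition primitive :: "functional \<Rightarrow> ereal \<Rightarrow> real" where
  "primitive f = (THE F. is_primitive F f)"

definition cp_integrable :: "functional \<Rightarrow> (ereal \<Rightarrow> real) \<Rightarrow> bool" where
  "cp_integrable f g \<longleftrightarrow>
     f \<in> A_C \<and> bounded_variation g \<and> (\<exists>I. has_RS_integral (primitive f) g I)"

definition cp_integral :: "functional \<Rightarrow> (ereal \<Rightarrow> real) \<Rightarrow> real" where
  "cp_integral f g = primitive f \<infinity> * g \<infinity> - RS_integral (primitive f) g"

section \<open>Harmonic functions\<close>

definition partial :: "'a::euclidean_space \<Rightarrow> ('a \<Rightarrow> real) \<Rightarrow> 'a \<Rightarrow> real" where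
  "partial b u z = deriv (\<lambda>s. u (z + s *\<^sub>R b)) 0"

definition C1_on :: "'a::euclidean_space set \<Rightarrow> ('a \<Rightarrow> real) \<Rightarrow> bool" where
  "C1_on S u \<longleftrightarrow>
     (\<forall>b\<in>Basis. (\<forall>z\<in>S. (\<lambda>s. u (z + s *\<^sub>R b)) field_differentiable (at 0)) \<and>
        continuous_on S (partial b u))"

definition C2_on :: "'a::euclidean_space set \<Rightarrow> ('a \<Rightarrow> real) \<Rightarrow> bool" where
  "C2_on S u \<longleftrightarrow> C1_on S u \<and> (\<forall>b\<in>Basis. C1_on S (partial b u))"

definition harmonic_on :: "'a::euclidean_space set \<Rightarrow> ('a \<Rightarrow> real) \<Rightarrow> bool" where
  "harmonic_on S u \<longleftrightarrow>
     open S \<and> C2_on S u \<and> (\<forall>z\<in>S. (\<Sum>b\<in>Basis. partial b (partial b u) z) = 0)"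

section \<open>The Poisson integral\<close>

definition poisson_kernel :: "real \<Rightarrow> real \<Rightarrow> real" where
  "poisson_kernel x y = y / (pi * (x\<^sup>2 + y\<^sup>2))"

definition poisson_integral :: "functional \<Rightarrow> real \<Rightarrow> real \<Rightarrow> real" where
  "poisson_integral f x y = cp_integral f (extend (\<lambda>t. poisson_kernel (x - t) y))"

end

(* Write z = x + i y. As a function of t, the Poisson kernel is Im (1 / (t - z)) / pi, a smooth
   function with integrable derivative - Im (1 / (t - z)^2) / pi that vanishes at both infinities.
   The Stieltjes integral of the (uniformly continuous, bounded) primitive F against it is therefore
   the Lebesgue integral of F times this derivative, so that u = Im G for the holomorphic function
   G z = 1/pi * integral of F(t) / (t - z)^2 dt on the upper half plane.  The imaginary part of a
   holomorphic function is harmonic.  That F can be recovered from f is the du Bois-Reymond lemma. *)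

theory Submission
  imports Defs "HOL-Complex_Analysis.Cauchy_Integral_Formula" "HOL-Probability.Sinc_Integral"
begin

text \<open>\<open>primitive\<close> is a definite description, so \<open>cp_integral\<close> cannot
  be evaluated before uniqueness of primitives is known. That in turn needs enough test functions,
  hence the bumps. The limit of F at infinity may be nonzero, so the integral of F(t) / (t - z)
  diverges in general. The definition of the integral moves the derivative to the kernel and yields
  the square in the denominator, which makes bounded F admissible. Cells of a partition may be
  unbounded and tags may be infinite. Small oscillation of F on cells therefore comes from
  compactness of [-oo, oo], and the errors stay summable because they are weighted by the finite
  measure with density |k'|, where k is the kernel as a function of t. Harmonicity here includes
  continuity of the first and second partial derivatives. Holomorphy supplies all of it after a
  single differentiation under the integral sign.\<close>

section \<open>Smooth functions and bumps\<close>

definition smooth :: "(real \<Rightarrow> real) \<Rightarrow> bool" where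
  "smooth f \<longleftrightarrow> (\<forall>n x. (deriv ^^ n) f field_differentiable (at x))"

text \<open>A derivative is unique, so all iterates of \<open>deriv\<close> stay in a class that is
  closed under differentiation. No formula for an n-th derivative is ever needed.\<close>

lemma smooth_coinduct:
  assumes "f \<in> A"
    and step: "\<And>f. f \<in> A \<Longrightarrow> \<exists>g\<in>A. \<forall>x. (f has_field_derivative g x) (at x)"
  shows "smooth f"
proof -
  have "(deriv ^^ n) f \<in> A" for n
  proof (induction n)
    case (Suc n)
    then obtain g where g: "g \<in> A" "\<And>x. ((deriv ^^ n) f has_field_derivative g x) (at x)"
      using step by blast
    then have "deriv ((deriv ^^ n) f) = g"
      using DERIV_imp_deriv by blast
    with g show ?case by simp
  qed (use assms in simp)
  then show ?thesis
    unfolding smooth_def field_differentiable_def using step by blast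
qed

lemma smooth_differentiable: "smooth f \<Longrightarrow> f field_differentiable (at x)"
  unfolding smooth_def by (drule spec[of _ 0]) simp

lemma smooth_has_deriv: "smooth f \<Longrightarrow> (f has_field_derivative deriv f x) (at x)"
  using smooth_differentiable field_differentiable_derivI by blast

lemma smooth_deriv: "smooth f \<Longrightarrow> smooth (deriv f)"
  unfolding smooth_def
proof (intro allI)
  fix n x
  assume "\<forall>n x. (deriv ^^ n) f field_differentiable (at x)"
  then have "(deriv ^^ Suc n) f field_differentiable (at x)" by blast
  then show "(deriv ^^ n) (deriv f) field_differentiable (at x)"
    by (simp only: funpow_Suc_right comp_apply)
qed

lemma smooth_continuous: "smooth f \<Longrightarrow> continuous_on S f"
  by (auto intro!: continuous_at_imp_continuous_on DERIV_isCont[OF smooth_has_deriv])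

lemma smooth_antiderivative:
  assumes "smooth g" and "\<And>x. (f has_field_derivative g x) (at x)"
  shows "smooth f"
proof (rule smooth_coinduct[where A = "insert f (Collect smooth)"])
  fix h assume "h \<in> insert f (Collect smooth)"
  then show "\<exists>h'\<in>insert f (Collect smooth). \<forall>x. (h has_field_derivative h' x) (at x)"
    using assms smooth_has_deriv[of h] smooth_deriv[of h] by blast
qed simp

lemma smooth_linear_combination:
  assumes "smooth f" "smooth g"
  shows "smooth (\<lambda>x. a * f x + b * g x)"
proof (rule smooth_coinduct[where A = "{\<lambda>x. a * f x + b * g x | f g. smooth f \<and> smooth g}"])
  fix h assume "h \<in> {\<lambda>x. a * f x + b * g x | f g. smooth f \<and> smooth g}"
  then obtain f g where h: "h = (\<lambda>x. a * f x + b * g x)" and fg: "smooth f" "smooth g"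
    by blast
  have "(h has_field_derivative a * deriv f x + b * deriv g x) (at x)" for x
    unfolding h by (intro DERIV_add DERIV_cmult smooth_has_deriv fg)
  moreover have "(\<lambda>x. a * deriv f x + b * deriv g x)
      \<in> {\<lambda>x. a * f x + b * g x | f g. smooth f \<and> smooth g}"
    using smooth_deriv[OF fg(1)] smooth_deriv[OF fg(2)] by auto
  ultimately show "\<exists>h'\<in>{\<lambda>x. a * f x + b * g x | f g. smooth f \<and> smooth g}.
      \<forall>x. (h has_field_derivative h' x) (at x)"
    by (rule_tac bexI[rotated]) auto
qed (use assms in auto)

text \<open>For fixed \<open>c < d\<close> the functions \<open>p / w\<^sup>k * exp (- 1 / w)\<close> with \<open>w = (x - c) * (d - x)\<close>,
  \<open>p\<close> a polynomial, are closed under differentiation.\<close>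

definition bump_family :: "real \<Rightarrow> real \<Rightarrow> real poly \<Rightarrow> nat \<Rightarrow> real \<Rightarrow> real" where
  "bump_family c d p k x = (if c < x \<and> x < d
     then poly p x / ((x - c) * (d - x)) ^ k * exp (- 1 / ((x - c) * (d - x))) else 0)"

text \<open>The series of \<open>exp (1 / w)\<close> has positive terms and so dominates its m-th
  term. The bound shows that the exponential beats every pole at w = 0.\<close>

lemma exp_neg_inverse_le:
  fixes w :: real
  assumes "w > 0"
  shows "exp (- 1 / w) \<le> fact m * w ^ m"
proof -
  have "(1 / w) ^ m / fact m \<le> exp (1 / w)"
  proof -
    have "(\<Sum>n\<in>{m}. inverse (fact n) *\<^sub>R (1 / w) ^ n) \<le> (\<Sum>n. inverse (fact n) *\<^sub>R (1 / w) ^ n)"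
      using assms by (intro sum_le_suminf summable_exp_generic) auto
    then show ?thesis
      by (simp add: exp_def field_simps)
  qed
  then have "1 \<le> exp (1 / w) * (fact m * w ^ m)"
    using assms by (simp add: field_simps power_divide)
  then have "exp (- 1 / w) * 1 \<le> exp (- 1 / w) * (exp (1 / w) * (fact m * w ^ m))"
    by (intro mult_left_mono) auto
  also have "\<dots> = fact m * w ^ m"
    by (simp flip: mult.assoc exp_add)
  finally show ?thesis by simp
qed

text \<open>Flatness off the open interval. For x inside, one factor of w is at most |x - x0| and
  the other at most d - c. The exponential is worth k + 2 powers of w: k of them cancel the pole,
  and two remain for the quadratic bound.\<close>

lemma bump_family_le:
  assumes "x0 \<le> c \<or> d \<le> x0"
  shows "\<exists>C. \<forall>x. \<bar>bump_family c d p k x\<bar> \<le> C * (x - x0)\<^sup>2"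
proof -
  have "bounded (poly p ` {c..d})"
    by (intro compact_imp_bounded compact_continuous_image continuous_intros) auto
  then obtain B where B: "\<And>x. x \<in> {c..d} \<Longrightarrow> \<bar>poly p x\<bar> \<le> B"
    unfolding bounded_iff by (auto simp del: atLeastAtMost_iff)
  define C where "C = \<bar>B\<bar> * fact (k + 2) * (d - c)\<^sup>2"
  have "\<bar>bump_family c d p k x\<bar> \<le> C * (x - x0)\<^sup>2" for x
  proof (cases "c < x \<and> x < d")
    case True
    define w where "w = (x - c) * (d - x)"
    have w: "w > 0" using True by (simp add: w_def)
    have "w \<le> (d - c) * \<bar>x - x0\<bar>"
      using assms
    proof
      assume "x0 \<le> c"
      then have "w \<le> \<bar>x - x0\<bar> * (d - c)"
        unfolding w_def using True by (intro mult_mono) auto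
      then show ?thesis by (simp add: mult.commute)
    next
      assume "d \<le> x0"
      then show ?thesis
        unfolding w_def using True by (intro mult_mono) auto
    qed
    then have w2: "w\<^sup>2 \<le> (d - c)\<^sup>2 * (x - x0)\<^sup>2"
      using power_mono[of w "(d - c) * \<bar>x - x0\<bar>" 2] w by (simp add: power_mult_distrib)
    have "\<bar>bump_family c d p k x\<bar> = \<bar>poly p x\<bar> / w ^ k * exp (- 1 / w)"
      using True w unfolding bump_family_def w_def by (simp add: abs_mult)
    also have "\<dots> \<le> \<bar>B\<bar> / w ^ k * (fact (k + 2) * w ^ (k + 2))"
      using B[of x] True w by (intro mult_mono divide_right_mono exp_neg_inverse_le) auto
    also have "\<dots> = \<bar>B\<bar> * fact (k + 2) * w\<^sup>2"
      using w by (simp add: power_add power2_eq_square del: fact_Suc)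
    also have "\<dots> \<le> \<bar>B\<bar> * fact (k + 2) * ((d - c)\<^sup>2 * (x - x0)\<^sup>2)"
      using w2 by (intro mult_left_mono) auto
    finally show ?thesis by (simp add: C_def mult_ac)
  next
    case False
    then show ?thesis by (auto simp: bump_family_def C_def)
  qed
  then show ?thesis by blast
qed

text \<open>The left side is what the product, quotient and power rules produce. The exponent k - 1
  is truncated at k = 0, hence the case split.\<close>

lemma bump_family_quotient_rule:
  fixes w :: real
  assumes "w > 0"
  shows "(p' * w ^ k - p * (of_nat k * w ^ (k - 1) * w')) / (w ^ k * w ^ k) * e
        + e * (w' / w\<^sup>2) * (p / w ^ k)
       = (p' * w\<^sup>2 - of_nat k * p * w' * w + p * w') / w ^ (k + 2) * e"
proof (cases k)
  case 0
  then show ?thesis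
    using assms by (simp add: field_simps power2_eq_square)
next
  case (Suc j)
  have "(p' * w ^ k - p * (of_nat k * w ^ (k - 1) * w')) / (w ^ k * w ^ k)
     = (p' * w - of_nat k * p * w') / w ^ Suc k"
    using assms Suc by (simp add: divide_simps) (simp add: algebra_simps)
  then show ?thesis
    using assms by (simp add: divide_simps power2_eq_square) (simp add: algebra_simps)
qed

text \<open>\<open>W\<close> is (x - c) * (d - x) multiplied out. Inside the interval this is
  calculus. Elsewhere, end points included, the quadratic bound makes the difference quotient tend
  to 0, which is the value of the family there.\<close>

lemma bump_family_has_derivative:
  fixes c d :: real
  defines "W \<equiv> [:- (c * d), c + d, - 1:]"
  shows "(bump_family c d p k has_field_derivative
    bump_family c d (pderiv p * W\<^sup>2 - of_nat k * p * pderiv W * W + p * pderiv W) (k + 2) x) (at x)"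
    (is "(_ has_field_derivative bump_family c d ?q _ x) _")
proof (cases "c < x \<and> x < d")
  case True
  define w where "w = (\<lambda>x. poly W x)"
  have W: "w x = (x - c) * (d - x)" for x
    by (simp add: w_def W_def algebra_simps)
  have wpos: "w x > 0"
    using True by (simp add: W)
  have w': "(w has_field_derivative poly (pderiv W) x) (at x)"
    unfolding w_def by (rule poly_DERIV)
  have "((\<lambda>x. poly p x / w x ^ k * exp (- 1 / w x)) has_field_derivative
     poly ?q x / w x ^ (k + 2) * exp (- 1 / w x)) (at x)"
  proof (rule DERIV_cong)
    show "((\<lambda>x. poly p x / w x ^ k * exp (- 1 / w x)) has_field_derivative
       (poly (pderiv p) x * w x ^ k - poly p x * (of_nat k * w x ^ (k - 1) * poly (pderiv W) x))
          / (w x ^ k * w x ^ k) * exp (- 1 / w x)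
        + exp (- 1 / w x) * (poly (pderiv W) x / (w x)\<^sup>2) * (poly p x / w x ^ k)) (at x)"
    proof (rule DERIV_mult)
      show "((\<lambda>x. poly p x / w x ^ k) has_field_derivative
         (poly (pderiv p) x * w x ^ k - poly p x * (of_nat k * w x ^ (k - 1) * poly (pderiv W) x))
          / (w x ^ k * w x ^ k)) (at x)"
        using wpos by (intro DERIV_divide poly_DERIV DERIV_cong[OF DERIV_power[OF w']]) auto
      show "((\<lambda>x. exp (- 1 / w x)) has_field_derivative
          exp (- 1 / w x) * (poly (pderiv W) x / (w x)\<^sup>2)) (at x)"
        using wpos by (auto intro!: derivative_eq_intros w' simp: power2_eq_square)
    qed
    show "(poly (pderiv p) x * w x ^ k - poly p x * (of_nat k * w x ^ (k - 1) * poly (pderiv W) x))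
          / (w x ^ k * w x ^ k) * exp (- 1 / w x)
        + exp (- 1 / w x) * (poly (pderiv W) x / (w x)\<^sup>2) * (poly p x / w x ^ k)
       = poly ?q x / w x ^ (k + 2) * exp (- 1 / w x)"
      using bump_family_quotient_rule[OF wpos, of "poly (pderiv p) x" k "poly p x" "poly (pderiv W) x" "exp (- 1 / w x)"]
      by (simp add: w_def)
  qed
  then have "((\<lambda>x. poly p x / w x ^ k * exp (- 1 / w x)) has_field_derivative
     bump_family c d ?q (k + 2) x) (at x)"
    using True by (simp add: bump_family_def W)
  note deriv = this
  have ev: "\<forall>\<^sub>F x in nhds x. bump_family c d p k x = poly p x / w x ^ k * exp (- 1 / w x)"
  proof -
    have "\<forall>\<^sub>F x in nhds x. x \<in> {c<..<d}"
      using True by (intro eventually_nhds_in_open) auto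
    then show ?thesis
      by eventually_elim (simp add: bump_family_def W)
  qed
  show ?thesis
    by (rule iffD2[OF DERIV_cong_ev[OF refl ev refl] deriv])
next
  case False
  then have "x \<le> c \<or> d \<le> x" by linarith
  then obtain C where C: "\<bar>bump_family c d p k y\<bar> \<le> C * (y - x)\<^sup>2" for y
    using bump_family_le by meson
  have 0: "bump_family c d q k x = 0" for q k
    using False by (auto simp: bump_family_def)
  have "((\<lambda>y. bump_family c d p k y / (y - x)) \<longlongrightarrow> 0) (at x)"
  proof (rule Lim_null_comparison)
    show "\<forall>\<^sub>F y in at x. norm (bump_family c d p k y / (y - x)) \<le> C * \<bar>y - x\<bar>"
      unfolding eventually_at_filter
    proof (intro always_eventually allI impI)
      fix y assume "y \<noteq> x"
      then have "\<bar>y - x\<bar> > 0" by simp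
      moreover have "\<bar>bump_family c d p k y\<bar> \<le> C * \<bar>y - x\<bar> * \<bar>y - x\<bar>"
        using C[of y] by (simp add: power2_eq_square)
      ultimately show "norm (bump_family c d p k y / (y - x)) \<le> C * \<bar>y - x\<bar>"
        by (simp add: pos_divide_le_eq)
    qed
    show "((\<lambda>y. C * \<bar>y - x\<bar>) \<longlongrightarrow> 0) (at x)"
      by (auto intro!: tendsto_eq_intros)
  qed
  then show ?thesis
    by (simp add: has_field_derivative_iff 0)
qed

lemma smooth_bump_family: "smooth (bump_family c d p k)"
proof (rule smooth_coinduct[where A = "{bump_family c d p k | p k. True}"])
  fix f assume "f \<in> {bump_family c d p k | p k. True}"
  then obtain p k where f: "f = bump_family c d p k" by auto
  show "\<exists>g\<in>{bump_family c d p k | p k. True}. \<forall>x. (f has_field_derivative g x) (at x)"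
    unfolding f by (rule bexI, rule allI, rule bump_family_has_derivative) auto
qed auto

section \<open>The du Bois-Reymond lemma\<close>

text \<open>On the line, the closure of a set is compact iff the set is bounded. The interval may be
  empty.\<close>

lemma test_functions_iff:
  "\<phi> \<in> test_functions \<longleftrightarrow> smooth \<phi> \<and> (\<exists>a b. \<forall>x. x \<notin> {a..b} \<longrightarrow> \<phi> x = 0)"
proof -
  have "bounded {x. \<phi> x \<noteq> 0} \<longleftrightarrow> (\<exists>a b. \<forall>x. x \<notin> {a..b} \<longrightarrow> \<phi> x = 0)"
  proof
    assume "bounded {x. \<phi> x \<noteq> 0}"
    then obtain a where "{x. \<phi> x \<noteq> 0} \<subseteq> cbox (-a) a"
      using bounded_subset_cbox_symmetric by blast
    then have "\<forall>x. x \<notin> {-a..a} \<longrightarrow> \<phi> x = 0" by auto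
    then show "\<exists>a b. \<forall>x. x \<notin> {a..b} \<longrightarrow> \<phi> x = 0" by blast
  next
    assume "\<exists>a b. \<forall>x. x \<notin> {a..b} \<longrightarrow> \<phi> x = 0"
    then obtain a b where "{x. \<phi> x \<noteq> 0} \<subseteq> {a..b}" by blast
    then show "bounded {x. \<phi> x \<noteq> 0}"
      using bounded_subset bounded_closed_interval by blast
  qed
  then show ?thesis
    by (simp add: test_functions_def smooth_def compact_closure)
qed

lemma deriv_test_function:
  assumes "\<phi> \<in> test_functions"
  shows "deriv \<phi> \<in> test_functions"
proof -
  obtain a b where \<phi>: "smooth \<phi>" and 0: "\<And>x. x \<notin> {a..b} \<Longrightarrow> \<phi> x = 0"
    using assms unfolding test_functions_iff by blast
  have "deriv \<phi> x = 0" if "x \<notin> {a..b}" for x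
  proof -
    have "\<forall>\<^sub>F y in nhds x. y \<in> - {a..b}"
      using that by (intro eventually_nhds_in_open) auto
    then have "\<forall>\<^sub>F y in nhds x. \<phi> y = 0"
      by eventually_elim (use 0 in auto)
    then have "deriv \<phi> x = deriv (\<lambda>_. 0) x"
      by (rule deriv_cong_ev) simp
    then show ?thesis by simp
  qed
  then show ?thesis
    using smooth_deriv[OF \<phi>] unfolding test_functions_iff by blast
qed

lemma test_function_linear_combination:
  assumes "\<phi> \<in> test_functions" "\<psi> \<in> test_functions"
  shows "(\<lambda>x. r * \<phi> x + s * \<psi> x) \<in> test_functions"
proof -
  obtain a b where \<phi>: "smooth \<phi>" "\<And>x. x \<notin> {a..b} \<Longrightarrow> \<phi> x = 0"
    using assms(1) unfolding test_functions_iff by blast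
  obtain a' b' where \<psi>: "smooth \<psi>" "\<And>x. x \<notin> {a'..b'} \<Longrightarrow> \<psi> x = 0"
    using assms(2) unfolding test_functions_iff by blast
  have "r * \<phi> x + s * \<psi> x = 0" if "x \<notin> {min a a'..max b b'}" for x
    using that \<phi>(2)[of x] \<psi>(2)[of x] by (auto simp: min_def max_def split: if_splits)
  then show ?thesis
    using smooth_linear_combination[OF \<phi>(1) \<psi>(1)] unfolding test_functions_iff by blast
qed

lemma integrable_mult_test_function:
  assumes "continuous_on UNIV h" "\<phi> \<in> test_functions"
  shows "integrable lborel (\<lambda>x. h x * \<phi> x)"
proof -
  obtain a b where \<phi>: "smooth \<phi>" and 0: "\<And>x. x \<notin> {a..b} \<Longrightarrow> \<phi> x = 0"
    using assms(2) unfolding test_functions_iff by blast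
  have "continuous_on {a..b} (\<lambda>x. h x * \<phi> x)"
    by (intro continuous_intros smooth_continuous \<phi> continuous_on_subset[OF assms(1)]) auto
  then have "integrable lborel (\<lambda>x. indicator {a..b} x *\<^sub>R (h x * \<phi> x))"
    by (intro borel_integrable_compact) auto
  also have "(\<lambda>x. indicator {a..b} x *\<^sub>R (h x * \<phi> x)) = (\<lambda>x. h x * \<phi> x)"
    by (rule ext) (use 0 in \<open>auto split: split_indicator\<close>)
  finally show ?thesis .
qed

lemma integrable_test_function: "\<phi> \<in> test_functions \<Longrightarrow> integrable lborel \<phi>"
  using integrable_mult_test_function[of "\<lambda>_. 1" \<phi>] by simp

section \<open>Antiderivatives and approximate identities\<close>

text \<open>The antiderivative that vanishes to the left of the support equals the total integral to
  the right of it, so mean zero is exactly what compact support requires.\<close>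

lemma test_function_antiderivative:
  assumes \<psi>: "\<psi> \<in> test_functions" and int0: "(\<integral>x. \<psi> x \<partial>lborel) = 0"
  obtains \<phi> where "\<phi> \<in> test_functions" "deriv \<phi> = \<psi>"
proof -
  obtain a0 b0 where sm: "smooth \<psi>" and supp: "\<And>x. x \<notin> {a0..b0} \<Longrightarrow> \<psi> x = 0"
    using \<psi> unfolding test_functions_iff by blast
  \<comment> \<open>Subtracting 1 makes \<open>\<psi>\<close> vanish at \<open>a\<close> itself, as
    closed intervals ending in \<open>a\<close> are used below. The maximum gives
    \<open>a \<le> c\<close> even when the interval from \<open>a0\<close> to \<open>b0\<close> is
    empty.\<close>
  define a c where "a = a0 - 1" and "c = max a0 b0"
  have 0: "\<psi> x = 0" if "x \<le> a \<or> c < x" for x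
    using that by (intro supp) (auto simp: a_def c_def)
  have "a \<le> c" by (simp add: a_def c_def)
  have "continuous_on UNIV \<psi>" by (rule smooth_continuous[OF sm])
  then have cont: "isCont \<psi> x" for x
    by (simp add: continuous_on_eq_continuous_at)
  obtain \<Psi> where \<Psi>: "\<And>x. (\<Psi> has_real_derivative \<psi> x) (at x)"
    using einterval_antiderivative[of "-\<infinity>" "\<infinity>" \<psi>] cont
    by (auto simp: has_real_derivative_iff_has_vector_derivative)
  define \<phi> where "\<phi> x = \<Psi> x - \<Psi> a" for x
  have \<phi>': "(\<phi> has_real_derivative \<psi> x) (at x)" for x
    unfolding \<phi>_def by (auto intro!: derivative_eq_intros \<Psi>)
  have "\<phi> x = 0" if "x \<notin> {a..c}" for x
  proof (cases "x < a")
    case True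
    have "\<phi> a - \<phi> x = (\<integral>y. \<psi> y * indicator {x..a} y \<partial>lborel)"
      using True by (intro integral_FTC_Icc_real[symmetric] \<phi>' cont) auto
    also have "(\<lambda>y. \<psi> y * indicator {x..a} y) = (\<lambda>_. 0)"
      by (rule ext) (auto simp: 0 split: split_indicator)
    finally show ?thesis by (simp add: \<phi>_def)
  next
    case False
    with that have "x > c" by auto
    have "\<phi> x - \<phi> a = (\<integral>y. \<psi> y * indicator {a..x} y \<partial>lborel)"
      using \<open>x > c\<close> \<open>a \<le> c\<close> by (intro integral_FTC_Icc_real[symmetric] \<phi>' cont) auto
    also have "(\<lambda>y. \<psi> y * indicator {a..x} y) = \<psi>"
      by (rule ext) (use \<open>x > c\<close> in \<open>auto simp: 0 split: split_indicator\<close>)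
    finally show ?thesis by (simp add: \<phi>_def int0)
  qed
  moreover have "smooth \<phi>"
    by (rule smooth_antiderivative[OF sm \<phi>'])
  moreover have "deriv \<phi> = \<psi>"
    using DERIV_imp_deriv[OF \<phi>'] by blast
  ultimately show ?thesis
    using that unfolding test_functions_iff by blast
qed

text \<open>The basic bump divided by its mass. The mass is positive: otherwise the bump would
  vanish almost everywhere, although it is positive on an interval of positive length.\<close>

lemma bump_test_function:
  assumes "c < d"
  obtains \<rho> where "\<rho> \<in> test_functions" "\<And>x. \<rho> x \<ge> 0" "\<And>x. x \<notin> {c<..<d} \<Longrightarrow> \<rho> x = 0"
    "(\<integral>x. \<rho> x \<partial>lborel) = 1"
proof -
  define \<rho> where "\<rho> = bump_family c d 1 0"
  define M where "M = (\<integral>x. \<rho> x \<partial>lborel)"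
  have 0: "\<rho> x = 0" if "x \<notin> {c<..<d}" for x
    using that by (auto simp: \<rho>_def bump_family_def)
  have nn: "\<rho> x \<ge> 0" for x
    by (simp add: \<rho>_def bump_family_def)
  have "\<forall>x. x \<notin> {c..d} \<longrightarrow> \<rho> x = 0"
    using 0 by auto
  then have test: "\<rho> \<in> test_functions"
    unfolding test_functions_iff by (auto simp: \<rho>_def smooth_bump_family)
  have "M \<noteq> 0"
  proof
    assume "M = 0"
    then have "AE x in lborel. \<rho> x = 0"
      using integral_nonneg_eq_0_iff_AE[OF integrable_test_function[OF test]] nn
      by (simp add: M_def)
    then have "AE x in lborel. x \<notin> {c<..<d}"
      by eventually_elim (auto simp: \<rho>_def bump_family_def)
    then have "{c<..<d} \<in> null_sets lborel"
      by (subst AE_iff_null_sets) auto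
    then show False
      using assms by (auto simp: null_sets_def)
  qed
  moreover have "M \<ge> 0"
    unfolding M_def using nn by (intro Bochner_Integration.integral_nonneg) auto
  ultimately have "M > 0" by simp
  show ?thesis
  proof (rule that)
    \<comment> \<open>A multiple is written as a linear combination with a zero coefficient to reuse
      the closure lemma.\<close>
    show "(\<lambda>x. 1 / M * \<rho> x + 0 * \<rho> x) \<in> test_functions"
      by (intro test_function_linear_combination test)
    show "(\<integral>x. 1 / M * \<rho> x + 0 * \<rho> x \<partial>lborel) = 1"
      using \<open>M > 0\<close> by (simp add: M_def[symmetric])
  qed (use nn \<open>M > 0\<close> 0 in auto)
qed

text \<open>A nonnegative bump of mass one just to the right of \<open>a\<close> averages h over
  points where h is within r of \<open>h a\<close>.\<close>

lemma approximate_evaluation: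
  fixes h :: "real \<Rightarrow> real"
  assumes h: "continuous_on UNIV h" and "r > 0"
  obtains \<rho> where "\<rho> \<in> test_functions" "(\<integral>x. \<rho> x \<partial>lborel) = 1"
    "\<bar>(\<integral>x. h x * \<rho> x \<partial>lborel) - h a\<bar> \<le> r"
proof -
  have "isCont h a"
    using h by (simp add: continuous_on_eq_continuous_at)
  then obtain e where e: "e > 0" "\<And>x. \<bar>x - a\<bar> < e \<Longrightarrow> \<bar>h x - h a\<bar> < r"
    using \<open>r > 0\<close> unfolding continuous_at_eps_delta dist_real_def by meson
  have "a < a + e" using \<open>e > 0\<close> by simp
  then obtain \<rho> where \<rho>: "\<rho> \<in> test_functions" "\<And>x. \<rho> x \<ge> 0" "\<And>x. x \<notin> {a<..<a+e} \<Longrightarrow> \<rho> x = 0"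
    "(\<integral>x. \<rho> x \<partial>lborel) = 1"
    by (rule bump_test_function) auto
  note int = integrable_mult_test_function[OF h \<rho>(1)] integrable_test_function[OF \<rho>(1)]
  have "(\<integral>x. h x * \<rho> x \<partial>lborel) - h a = (\<integral>x. h x * \<rho> x - h a * \<rho> x \<partial>lborel)"
    using int \<rho>(4) by (subst Bochner_Integration.integral_diff) auto
  also have "\<bar>\<dots>\<bar> \<le> (\<integral>x. \<bar>h x * \<rho> x - h a * \<rho> x\<bar> \<partial>lborel)"
    by (rule integral_abs_bound)
  also have "\<dots> \<le> (\<integral>x. r * \<rho> x \<partial>lborel)"
  proof (rule integral_mono)
    fix x
    show "\<bar>h x * \<rho> x - h a * \<rho> x\<bar> \<le> r * \<rho> x"
    proof (cases "x \<in> {a<..<a+e}")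
      case True
      then have "\<bar>h x - h a\<bar> * \<rho> x \<le> r * \<rho> x"
        using e(2)[of x] \<rho>(2)[of x] by (intro mult_right_mono) auto
      then show ?thesis
        using \<rho>(2)[of x] by (simp add: abs_mult flip: left_diff_distrib)
    qed (simp add: \<rho>(3))
  qed (use int in auto)
  finally show ?thesis
    using that[OF \<rho>(1,4)] \<rho>(4) by simp
qed

text \<open>The difference of mass-one bumps near a and b has mean zero, so it is the derivative of
  a test function. Orthogonality makes the two local averages of h equal.\<close>

lemma du_Bois_Reymond:
  fixes h :: "real \<Rightarrow> real"
  assumes h: "continuous_on UNIV h"
    and orth: "\<And>\<phi>. \<phi> \<in> test_functions \<Longrightarrow> (\<integral>x. h x * deriv \<phi> x \<partial>lborel) = 0"
  shows "h a = h b"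
proof (rule ccontr)
  assume "h a \<noteq> h b"
  \<comment> \<open>Each average is off by at most r, so a third of the gap leaves a
    contradiction.\<close>
  define r where "r = \<bar>h a - h b\<bar> / 3"
  have "r > 0" using \<open>h a \<noteq> h b\<close> by (simp add: r_def)
  obtain \<rho> where \<rho>: "\<rho> \<in> test_functions" "(\<integral>x. \<rho> x \<partial>lborel) = 1"
    "\<bar>(\<integral>x. h x * \<rho> x \<partial>lborel) - h a\<bar> \<le> r"
    by (rule approximate_evaluation[OF h \<open>r > 0\<close>])
  obtain \<sigma> where \<sigma>: "\<sigma> \<in> test_functions" "(\<integral>x. \<sigma> x \<partial>lborel) = 1"
    "\<bar>(\<integral>x. h x * \<sigma> x \<partial>lborel) - h b\<bar> \<le> r"
    by (rule approximate_evaluation[OF h \<open>r > 0\<close>])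
  define \<psi> where "\<psi> x = 1 * \<rho> x + (- 1) * \<sigma> x" for x
  have "\<psi> \<in> test_functions"
    unfolding \<psi>_def by (intro test_function_linear_combination \<rho> \<sigma>)
  moreover have "(\<integral>x. \<psi> x \<partial>lborel) = 0"
    unfolding \<psi>_def using \<rho> \<sigma> integrable_test_function by simp
  ultimately obtain \<phi> where "\<phi> \<in> test_functions" "deriv \<phi> = \<psi>"
    by (rule test_function_antiderivative)
  then have "(\<integral>x. h x * \<psi> x \<partial>lborel) = 0"
    using orth by blast
  moreover have "(\<integral>x. h x * \<psi> x \<partial>lborel) = (\<integral>x. h x * \<rho> x \<partial>lborel) - (\<integral>x. h x * \<sigma> x \<partial>lborel)"
    using integrable_mult_test_function[OF h \<rho>(1)] integrable_mult_test_function[OF h \<sigma>(1)]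
    by (simp add: \<psi>_def right_diff_distrib)
  ultimately have "\<bar>h a - h b\<bar> \<le> 2 * r"
    using \<rho>(3) \<sigma>(3) by linarith
  then show False
    using \<open>r > 0\<close> by (simp add: r_def)
qed

section \<open>Uniqueness of the primitive\<close>

lemma extend_simps [simp]:
  "extend h (ereal x) = h x" "extend h \<infinity> = Lim at_top h" "extend h (- \<infinity>) = Lim at_bot h"
  by (simp_all add: extend_def)

lemma B_C_cases:
  assumes "F \<in> B_C"
  obtains h L where "F = extend h" "continuous_on UNIV h" "(h \<longlongrightarrow> L) at_top" "(h \<longlongrightarrow> 0) at_bot"
proof -
  obtain h L l where h: "F = extend h" "continuous_on UNIV h" "(h \<longlongrightarrow> L) at_top" "(h \<longlongrightarrow> l) at_bot"
    using assms unfolding B_C_def C0_ext_def by blast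
  then have "l = 0"
    using assms tendsto_Lim[OF _ h(4)] by (simp add: B_C_def)
  with h that show ?thesis by blast
qed

text \<open>The difference of two primitives is orthogonal to all derivatives of test functions,
  hence constant. The limit 0 at -oo kills the constant.\<close>

lemma primitive_unique:
  assumes F: "is_primitive F f" and G: "is_primitive G f"
  shows "F = G"
proof -
  obtain h where h: "F = extend h" "continuous_on UNIV h" "(h \<longlongrightarrow> 0) at_bot"
    using F B_C_cases unfolding is_primitive_def by metis
  obtain k where k: "G = extend k" "continuous_on UNIV k" "(k \<longlongrightarrow> 0) at_bot"
    using G B_C_cases unfolding is_primitive_def by metis
  define H where "H x = h x - k x" for x
  have contH: "continuous_on UNIV H"
    unfolding H_def by (intro continuous_intros h k)
  have "(\<integral>x. H x * deriv \<phi> x \<partial>lborel) = 0" if \<phi>: "\<phi> \<in> test_functions" for \<phi>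
  proof -
    \<comment> \<open>Both operators are restricted to \<open>test_functions\<close>, so evaluation
      requires that \<open>\<phi>\<close> and \<open>deriv \<phi>\<close> both belong to it.\<close>
    have "distribution_deriv (distribution_of h) \<phi> = distribution_deriv (distribution_of k) \<phi>"
      using F G by (simp add: is_primitive_def h(1) k(1))
    then have "(\<integral>x. h x * deriv \<phi> x \<partial>lborel) = (\<integral>x. k x * deriv \<phi> x \<partial>lborel)"
      using \<phi> deriv_test_function[OF \<phi>]
      by (simp add: distribution_deriv_def distribution_of_def)
    then show ?thesis
      using integrable_mult_test_function[OF h(2) deriv_test_function[OF \<phi>]]
        integrable_mult_test_function[OF k(2) deriv_test_function[OF \<phi>]]
      by (simp add: H_def left_diff_distrib)
  qed
  then have const: "H x = H 0" for x
    by (rule du_Bois_Reymond[OF contH])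
  have "(H \<longlongrightarrow> 0) at_bot"
    unfolding H_def using tendsto_diff[OF h(3) k(3)] by simp
  moreover have "H = (\<lambda>_. H 0)"
    using const by blast
  ultimately have "H 0 = 0"
    by (metis tendsto_const tendsto_unique trivial_limit_at_bot_linorder)
  then have "h = k"
    using const by (auto simp: H_def)
  then show ?thesis by (simp add: h k)
qed

lemma primitive_eqI: "is_primitive F f \<Longrightarrow> primitive f = F"
  unfolding primitive_def using primitive_unique by blast

section \<open>Stieltjes integrals against a function with integrable derivative\<close>

lemma interval_integrable_of_integrable:
  fixes f :: "real \<Rightarrow> real"
  assumes "integrable lborel f"
  shows "interval_lebesgue_integrable lborel a b f" "set_integrable lborel (einterval a b) f"
proof -
  have "set_integrable lborel (einterval a b) f" for a b
    unfolding set_integrable_def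
    by (intro integrable_mult_indicator assms) auto
  then show "interval_lebesgue_integrable lborel a b f" "set_integrable lborel (einterval a b) f"
    by (simp_all add: interval_lebesgue_integrable_def)
qed

lemma interval_integral_diff_endpoints:
  fixes f :: "real \<Rightarrow> real"
  assumes "integrable lborel f"
  shows "(LBINT x=c..b. f x) - (LBINT x=c..a. f x) = (LBINT x=a..b. f x)"
  using interval_integral_sum[OF interval_integrable_of_integrable(1)[OF assms], of c a b] by simp

lemma interval_integral_UNIV: "(LBINT x=-\<infinity>..\<infinity>. f x) = (\<integral>x. f x \<partial>lborel)" for f :: "real \<Rightarrow> real"
  by (simp add: interval_lebesgue_integral_le_eq set_lebesgue_integral_def)

text \<open>Integrals over consecutive cells telescope to a part of the total mass of q. With q =
  |k'| this bounds the variation; with q = \<open>\<eta>\<close> * |k'| it bounds the error of a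
  Stieltjes sum.\<close>

lemma stieltjes_sum_bound:
  fixes t :: "nat \<Rightarrow> ereal" and q :: "real \<Rightarrow> real"
  assumes "integrable lborel q" "\<And>x. q x \<ge> 0"
    and t: "\<And>i. i < n \<Longrightarrow> t i \<le> t (Suc i)"
    and le: "\<And>i. i < n \<Longrightarrow> e i \<le> (LBINT x=t i..t (Suc i). q x)"
  shows "(\<Sum>i<n. e i) \<le> (\<integral>x. q x \<partial>lborel)"
proof -
  define V where "V a = (LBINT x=-\<infinity>..a. q x)" for a :: ereal
  have V: "V b - V a = (LBINT x=a..b. q x)" for a b
    unfolding V_def by (rule interval_integral_diff_endpoints) fact
  have V0: "0 \<le> V a" and V1: "V a \<le> (\<integral>x. q x \<partial>lborel)" for a
  proof -
    show "0 \<le> V a"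
      unfolding V_def using assms(2)
      by (auto simp: interval_lebesgue_integral_le_eq set_lebesgue_integral_def
          intro!: Bochner_Integration.integral_nonneg)
    have "V \<infinity> - V a \<ge> 0"
      unfolding V using assms(2)
      by (auto simp: interval_lebesgue_integral_le_eq set_lebesgue_integral_def
          intro!: Bochner_Integration.integral_nonneg)
    then show "V a \<le> (\<integral>x. q x \<partial>lborel)"
      by (simp add: V_def interval_integral_UNIV)
  qed
  have "(\<Sum>i<n. e i) \<le> (\<Sum>i<n. V (t (Suc i)) - V (t i))"
    using le by (intro sum_mono) (simp add: V)
  also have "\<dots> = V (t n) - V (t 0)"
    by (rule sum_lessThan_telescope)
  also have "\<dots> \<le> (\<integral>x. q x \<partial>lborel)"
    using V0[of "t 0"] V1[of "t n"] by linarith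
  finally show ?thesis .
qed

section \<open>Integrators dk = k' dx\<close>

locale integrator =
  fixes k k' :: "real \<Rightarrow> real" and l m :: real
  assumes deriv: "\<And>x. (k has_real_derivative k' x) (at x)"
    and continuous: "continuous_on UNIV k'"
    and integrable: "integrable lborel k'"
    and at_top: "(k \<longlongrightarrow> l) at_top"
    and at_bot: "(k \<longlongrightarrow> m) at_bot"
begin

lemma extend_infinity: "extend k \<infinity> = l" "extend k (-\<infinity>) = m"
  by (simp_all add: tendsto_Lim[OF _ at_top] tendsto_Lim[OF _ at_bot])

lemma isCont: "isCont k x"
  using deriv DERIV_isCont by blast

text \<open>The fundamental theorem of calculus. At an infinite end point the limit of k takes the
  place of continuity.\<close>

lemma increment:
  assumes "a \<le> b"
  shows "extend k b - extend k a = (LBINT x=a..b. k' x)"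
proof (cases "a = b")
  case False
  then have "a < b" using assms by simp
  have "(LBINT x=a..b. k' x) = extend k b - extend k a"
  proof (rule interval_integral_FTC_integrable[where F = k, OF \<open>a < b\<close>])
    show "(k has_vector_derivative k' x) (at x)" for x
      using deriv has_real_derivative_iff_has_vector_derivative by blast
    show "isCont k' x" for x
      using continuous by (simp add: continuous_on_eq_continuous_at)
    show "set_integrable lborel (einterval a b) k'"
      by (rule interval_integrable_of_integrable[OF integrable])
    have k: "(k \<longlongrightarrow> k r) (at r within A)" for r A
      using isCont[of r] by (metis continuous_at_imp_continuous_at_within continuous_within)
    show "((k \<circ> real_of_ereal) \<longlongrightarrow> extend k a) (at_right a)"
      using \<open>a < b\<close> k at_bot extend_infinity
      by (cases a) (auto simp del: extend_simps(2,3) simp: ereal_tendsto_simps1)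
    show "((k \<circ> real_of_ereal) \<longlongrightarrow> extend k b) (at_left b)"
      using \<open>a < b\<close> k at_top extend_infinity
      by (cases b) (auto simp del: extend_simps(2,3) simp: ereal_tendsto_simps1)
  qed
  then show ?thesis by simp
qed simp

lemma bounded_variation: "bounded_variation (extend k)"
  unfolding bounded_variation_def
proof (intro exI allI impI)
  fix n and t :: "nat \<Rightarrow> ereal"
  assume t: "\<forall>i<n. t i \<le> t (Suc i)"
  show "(\<Sum>i<n. \<bar>extend k (t (Suc i)) - extend k (t i)\<bar>) \<le> (\<integral>x. \<bar>k' x\<bar> \<partial>lborel)"
  proof (rule stieltjes_sum_bound)
    fix i assume "i < n"
    then have "t i \<le> t (Suc i)" using t by simp
    then show "\<bar>extend k (t (Suc i)) - extend k (t i)\<bar> \<le> (LBINT x=t i..t (Suc i). \<bar>k' x\<bar>)"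
      using set_integral_norm_bound[OF interval_integrable_of_integrable(2)[OF integrable]]
      by (simp add: increment interval_lebesgue_integral_le_eq)
  qed (use t integrable in auto)
qed

text \<open>With v the value at the tag of a cell, the left side is the integral of (v - h) * k'.
  Only real points strictly inside the cell contribute, so the oscillation is needed only
  there.\<close>

lemma increment_approximation:
  assumes "a \<le> b" and hk: "integrable lborel (\<lambda>x. h x * k' x)"
    and osc: "\<And>x. a < ereal x \<Longrightarrow> ereal x < b \<Longrightarrow> \<bar>v - h x\<bar> \<le> \<eta>"
  shows "\<bar>v * (extend k b - extend k a) - (LBINT x=a..b. h x * k' x)\<bar>
    \<le> (LBINT x=a..b. \<eta> * \<bar>k' x\<bar>)"
proof -
  let ?S = "einterval a b"
  have int: "set_integrable lborel ?S (\<lambda>x. v * k' x)" "set_integrable lborel ?S (\<lambda>x. h x * k' x)"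
    using hk integrable by (auto intro!: interval_integrable_of_integrable(2))
  have "v * (extend k b - extend k a) - (LBINT x=a..b. h x * k' x)
      = (LBINT x:?S. v * k' x - h x * k' x)"
    using int by (simp add: increment assms interval_lebesgue_integral_le_eq)
  also have "\<bar>\<dots>\<bar> \<le> (LBINT x:?S. \<bar>v * k' x - h x * k' x\<bar>)"
    using set_integral_norm_bound[OF set_integral_diff(1)[OF int]] by simp
  also have "\<dots> \<le> (LBINT x:?S. \<eta> * \<bar>k' x\<bar>)"
  proof (rule set_integral_mono)
    show "set_integrable lborel ?S (\<lambda>x. \<bar>v * k' x - h x * k' x\<bar>)"
      by (intro set_integrable_abs set_integral_diff int)
    show "set_integrable lborel ?S (\<lambda>x. \<eta> * \<bar>k' x\<bar>)"
      using integrable by (intro interval_integrable_of_integrable(2)) auto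
    fix x assume "x \<in> ?S"
    then have "\<bar>v - h x\<bar> * \<bar>k' x\<bar> \<le> \<eta> * \<bar>k' x\<bar>"
      by (intro mult_right_mono osc) (auto simp: einterval_def)
    then show "\<bar>v * k' x - h x * k' x\<bar> \<le> \<eta> * \<bar>k' x\<bar>"
      by (simp flip: abs_mult left_diff_distrib)
  qed
  finally show ?thesis
    using \<open>a \<le> b\<close> by (simp only: interval_lebesgue_integral_le_eq)
qed

end

text \<open>The open set \<open>U\<close> around \<open>s\<close> is an interval whose finite end points are collected in \<open>P\<close>.\<close>

lemma local_oscillation:
  assumes h: "continuous_on UNIV h" "(h \<longlongrightarrow> L) at_top" "(h \<longlongrightarrow> M) at_bot" and "\<eta> > 0"
  shows "\<exists>U P. open U \<and> s \<in> U \<and> finite P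
    \<and> (\<forall>u\<in>U. \<forall>x. ereal x \<in> U \<longrightarrow> \<bar>extend h u - h x\<bar> \<le> \<eta>)
    \<and> (\<forall>u\<in>U. \<forall>x. x \<notin> U \<longrightarrow> (\<exists>p\<in>P. u < p \<and> p \<le> x \<or> x \<le> p \<and> p < u))"
proof -
  have inf: "extend h \<infinity> = L" "extend h (-\<infinity>) = M"
    by (simp_all add: tendsto_Lim[OF _ h(2)] tendsto_Lim[OF _ h(3)])
  \<comment> \<open>Both values are compared with a common centre c, which explains the tolerance
    \<open>\<eta> / 2\<close> in all three cases.\<close>
  have combine: "\<bar>extend h u - h x\<bar> \<le> \<eta>"
    if "\<And>v. v \<in> U \<Longrightarrow> \<bar>extend h v - c\<bar> < \<eta> / 2" "u \<in> U" "ereal x \<in> U" for U c u x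
    using that(1)[OF that(2)] that(1)[OF that(3)] unfolding extend_simps by linarith
  show ?thesis
  proof (cases s)
    case (real r)
    have "isCont h r"
      using h(1) by (simp add: continuous_on_eq_continuous_at)
    then obtain d where d: "d > 0" "\<And>x. \<bar>x - r\<bar> < d \<Longrightarrow> \<bar>h x - h r\<bar> < \<eta> / 2"
      using \<open>\<eta> > 0\<close> unfolding continuous_at_eps_delta dist_real_def by (meson half_gt_zero)
    let ?U = "{ereal (r - d)<..<ereal (r + d)}"
    have "\<bar>extend h v - h r\<bar> < \<eta> / 2" if "v \<in> ?U" for v
      using that d(2) by (cases v) auto
    then show ?thesis
      using combine[of ?U "h r"] d(1) real
      by (intro exI[of _ ?U] exI[of _ "{ereal (r - d), ereal (r + d)}"]) (auto simp: not_less)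
  next
    case PInf
    have "\<forall>\<^sub>F x in at_top. \<bar>h x - L\<bar> < \<eta> / 2"
      using tendstoD[OF h(2), of "\<eta> / 2"] \<open>\<eta> > 0\<close> by (simp add: dist_real_def)
    then obtain N where N: "\<And>x. x \<ge> N \<Longrightarrow> \<bar>h x - L\<bar> < \<eta> / 2"
      unfolding eventually_at_top_linorder by blast
    let ?U = "{ereal N<..}"
    have "\<bar>extend h v - L\<bar> < \<eta> / 2" if "v \<in> ?U" for v
      using that N inf \<open>\<eta> > 0\<close> by (cases v) (auto simp del: extend_simps(2,3))
    then show ?thesis
      using combine[of ?U L] PInf
      by (intro exI[of _ ?U] exI[of _ "{ereal N}"]) (auto simp: not_less)
  next
    case MInf
    have "\<forall>\<^sub>F x in at_bot. \<bar>h x - M\<bar> < \<eta> / 2"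
      using tendstoD[OF h(3), of "\<eta> / 2"] \<open>\<eta> > 0\<close> by (simp add: dist_real_def)
    then obtain N where N: "\<And>x. x \<le> N \<Longrightarrow> \<bar>h x - M\<bar> < \<eta> / 2"
      unfolding eventually_at_bot_linorder by blast
    let ?U = "{..<ereal N}"
    have "\<bar>extend h v - M\<bar> < \<eta> / 2" if "v \<in> ?U" for v
      using that N inf \<open>\<eta> > 0\<close> by (cases v) (auto simp del: extend_simps(2,3))
    then show ?thesis
      using combine[of ?U M] MInf
      by (intro exI[of _ ?U] exI[of _ "{ereal N}"]) (auto simp: not_less)
  qed
qed

text \<open>P collects the end points of a finite subcover of the compact extended line. The tag s
  lies in some member of the cover. If x did not, an end point p would separate them and lie
  strictly between a and b. The tag may equal a or b while x may not, so p must be strictly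
  separated from s but may coincide with x.\<close>

lemma uniform_oscillation:
  assumes h: "continuous_on UNIV h" "(h \<longlongrightarrow> L) at_top" "(h \<longlongrightarrow> M) at_bot" and "\<eta> > 0"
  obtains P where "finite P"
    "\<And>a b s x. (\<And>p. p \<in> P \<Longrightarrow> \<not> (a < p \<and> p < b)) \<Longrightarrow> a \<le> s \<Longrightarrow> s \<le> b \<Longrightarrow>
       a < ereal x \<Longrightarrow> ereal x < b \<Longrightarrow> \<bar>extend h s - h x\<bar> \<le> \<eta>"
proof -
  have "\<exists>U P. open U \<and> s \<in> U \<and> finite P
    \<and> (\<forall>u\<in>U. \<forall>x. ereal x \<in> U \<longrightarrow> \<bar>extend h u - h x\<bar> \<le> \<eta>)
    \<and> (\<forall>u\<in>U. \<forall>x. x \<notin> U \<longrightarrow> (\<exists>p\<in>P. u < p \<and> p \<le> x \<or> x \<le> p \<and> p < u))" for s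
    by (rule local_oscillation[OF assms])
  then obtain U P where U: "\<And>s. open (U s)" "\<And>s. s \<in> U s" and P: "\<And>s. finite (P s)"
    and osc: "\<And>s u x. u \<in> U s \<Longrightarrow> ereal x \<in> U s \<Longrightarrow> \<bar>extend h u - h x\<bar> \<le> \<eta>"
    and bdry: "\<And>s u x. u \<in> U s \<Longrightarrow> x \<notin> U s \<Longrightarrow> \<exists>p\<in>P s. u < p \<and> p \<le> x \<or> x \<le> p \<and> p < u"
    by metis
  have "compact (UNIV :: ereal set)"
    by (rule compact_UNIV)
  then obtain D where D: "finite D" "UNIV \<subseteq> (\<Union>s\<in>D. U s)"
    using U compactE_image[of UNIV UNIV U] by (metis UNIV_I UN_I subsetI)
  show ?thesis
  proof (rule that)
    show "finite (\<Union>s\<in>D. P s)"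
      using D P by blast
    fix a b s x
    assume no: "\<And>p. p \<in> (\<Union>s\<in>D. P s) \<Longrightarrow> \<not> (a < p \<and> p < b)"
      and s: "a \<le> s" "s \<le> b" and x: "a < ereal x" "ereal x < b"
    obtain r where r: "r \<in> D" "s \<in> U r" using D by blast
    have "ereal x \<in> U r"
    proof (rule ccontr)
      assume "ereal x \<notin> U r"
      then obtain p where p: "p \<in> P r" "s < p \<and> p \<le> ereal x \<or> ereal x \<le> p \<and> p < s"
        using bdry r by blast
      then have "a < p \<and> p < b"
        using s x by auto
      then show False
        using no p(1) r(1) by blast
    qed
    then show "\<bar>extend h s - h x\<bar> \<le> \<eta>"
      using osc r(2) by blast
  qed
qed

text \<open>Shows that no prescribed point of P lies strictly inside a cell, as
  \<open>uniform_oscillation\<close> demands.\<close>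

lemma partition_gap:
  fixes t :: "nat \<Rightarrow> 'a::linorder"
  assumes t: "\<And>i. i < n \<Longrightarrow> t i < t (Suc i)" and "i < n" "j \<le> n"
  shows "\<not> (t i < t j \<and> t j < t (Suc i))"
proof -
  have mono: "i \<le> j \<Longrightarrow> j \<le> n \<Longrightarrow> t i \<le> t j" for i j
  proof (induction j rule: dec_induct)
    case (step j)
    then show ?case
      using t[of j] by simp
  qed simp
  show ?thesis
    using mono[of j i] mono[of "Suc i" j] assms by (cases "j \<le> i") auto
qed

text \<open>The sum minus the integral splits into one error per cell, each at most
  \<open>\<eta>\<close> times the integral of |k'| over that cell.\<close>

lemma (in integrator) has_RS_integral:
  assumes h: "continuous_on UNIV h" "(h \<longlongrightarrow> L) at_top" "(h \<longlongrightarrow> M) at_bot"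
    and hk: "integrable lborel (\<lambda>x. h x * k' x)"
  shows "has_RS_integral (extend h) (extend k) (\<integral>x. h x * k' x \<partial>lborel)"
  unfolding has_RS_integral_def
proof (intro allI impI)
  fix \<epsilon> :: real assume "\<epsilon> > 0"
  define A where "A = (\<integral>x. \<bar>k' x\<bar> \<partial>lborel)"
  have "A \<ge> 0" by (simp add: A_def)
  \<comment> \<open>The summand 1 covers A = 0 and makes \<open>\<eta> * A < \<epsilon>\<close>
    strict.\<close>
  define \<eta> where "\<eta> = \<epsilon> / (A + 1)"
  have "\<eta> > 0" using \<open>\<epsilon> > 0\<close> \<open>A \<ge> 0\<close> by (simp add: \<eta>_def)
  have "\<eta> * A < \<epsilon>"
    using \<open>\<epsilon> > 0\<close> \<open>A \<ge> 0\<close> by (simp add: \<eta>_def field_simps)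
  obtain P where P: "finite P"
    and osc: "\<And>a b s x. (\<And>p. p \<in> P \<Longrightarrow> \<not> (a < p \<and> p < b)) \<Longrightarrow> a \<le> s \<Longrightarrow> s \<le> b \<Longrightarrow>
       a < ereal x \<Longrightarrow> ereal x < b \<Longrightarrow> \<bar>extend h s - h x\<bar> \<le> \<eta>"
    using uniform_oscillation[OF h \<open>\<eta> > 0\<close>] by blast
  define J where "J a = (LBINT x=-\<infinity>..a. h x * k' x)" for a :: ereal
  have J: "J b - J a = (LBINT x=a..b. h x * k' x)" for a b
    unfolding J_def by (rule interval_integral_diff_endpoints[OF hk])
  show "\<exists>P. finite P \<and> (\<forall>n t s. t 0 = - \<infinity> \<and> t n = \<infinity> \<and> (\<forall>i<n. t i < t (Suc i)) \<and> P \<subseteq> t ` {..n} \<and>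
           (\<forall>i<n. t i \<le> s i \<and> s i \<le> t (Suc i)) \<longrightarrow>
           \<bar>(\<Sum>i<n. extend h (s i) * (extend k (t (Suc i)) - extend k (t i)))
              - (\<integral>x. h x * k' x \<partial>lborel)\<bar> < \<epsilon>)"
  proof (intro exI conjI allI impI)
    show "finite P" by fact
    fix n and t s :: "nat \<Rightarrow> ereal"
    assume "t 0 = - \<infinity> \<and> t n = \<infinity> \<and> (\<forall>i<n. t i < t (Suc i)) \<and> P \<subseteq> t ` {..n} \<and>
           (\<forall>i<n. t i \<le> s i \<and> s i \<le> t (Suc i))"
    then have t0: "t 0 = - \<infinity>" and tn: "t n = \<infinity>" and t: "\<And>i. i < n \<Longrightarrow> t i < t (Suc i)"
      and Pt: "P \<subseteq> t ` {..n}" and s: "\<And>i. i < n \<Longrightarrow> t i \<le> s i \<and> s i \<le> t (Suc i)"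
      by auto
    define e where "e i = extend h (s i) * (extend k (t (Suc i)) - extend k (t i))
      - (LBINT x=t i..t (Suc i). h x * k' x)" for i
    have "(\<integral>x. h x * k' x \<partial>lborel) = J (t n) - J (t 0)"
      by (simp only: J t0 tn interval_integral_UNIV)
    also have "\<dots> = (\<Sum>i<n. J (t (Suc i)) - J (t i))"
      by (rule sum_lessThan_telescope[symmetric])
    finally have "(\<Sum>i<n. extend h (s i) * (extend k (t (Suc i)) - extend k (t i)))
        - (\<integral>x. h x * k' x \<partial>lborel) = (\<Sum>i<n. e i)"
      by (simp only: e_def J sum_subtractf)
    also have "\<bar>\<dots>\<bar> \<le> (\<Sum>i<n. \<bar>e i\<bar>)"
      by (rule sum_abs)
    also have "\<dots> \<le> (\<integral>x. \<eta> * \<bar>k' x\<bar> \<partial>lborel)"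
    proof (rule stieltjes_sum_bound)
      fix i assume "i < n"
      have gap: "\<not> (t i < p \<and> p < t (Suc i))" if "p \<in> P" for p
        using Pt that partition_gap[where n = n and t = t and i = i] t \<open>i < n\<close> by blast
      show "\<bar>e i\<bar> \<le> (LBINT x=t i..t (Suc i). \<eta> * \<bar>k' x\<bar>)"
        unfolding e_def
        using t[OF \<open>i < n\<close>] s[OF \<open>i < n\<close>] gap
        by (intro increment_approximation hk osc) auto
    qed (use t less_imp_le \<open>\<eta> > 0\<close> integrable in auto)
    also have "\<dots> = \<eta> * A" by (simp add: A_def)
    also have "\<dots> < \<epsilon>" by fact
    finally show "\<bar>(\<Sum>i<n. extend h (s i) * (extend k (t (Suc i)) - extend k (t i)))
              - (\<integral>x. h x * k' x \<partial>lborel)\<bar> < \<epsilon>" .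
  qed
qed

section \<open>Common refinements and uniqueness of the Stieltjes integral\<close>

lemma partition_exists:
  fixes P :: "ereal set"
  assumes "finite P"
  obtains n and t :: "nat \<Rightarrow> ereal" where "t 0 = - \<infinity>" "t n = \<infinity>" "\<forall>i<n. t i < t (Suc i)" "P \<subseteq> t ` {..n}"
proof -
  define Q where "Q = insert (-\<infinity>) (insert \<infinity> P)"
  have "finite Q" using assms by (simp add: Q_def)
  define xs where "xs = sorted_list_of_set Q"
  have xs: "set xs = Q" "sorted_wrt (<) xs"
    using \<open>finite Q\<close> by (simp_all add: xs_def)
  have "xs \<noteq> []" using xs by (auto simp: Q_def)
  define n where "n = length xs - 1"
  have len: "length xs = Suc n" using \<open>xs \<noteq> []\<close> by (simp add: n_def)
  have less: "xs ! i < xs ! j" if "i < j" "j \<le> n" for i j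
    using xs(2) that len by (simp add: sorted_wrt_iff_nth_less)
  have Q: "Q = (!) xs ` {..n}"
    using xs(1) len by (auto simp: set_conv_nth less_Suc_eq_le)
  then obtain i j where i: "i \<le> n" "xs ! i = -\<infinity>" and j: "j \<le> n" "xs ! j = \<infinity>"
    unfolding Q_def by (metis (no_types, lifting) atMost_iff imageE insertI1 insertI2)
  \<comment> \<open>The list is strictly increasing, so the least element must come first and the
    greatest last.\<close>
  have "i = 0"
    using less[of 0 i] i by (cases i) auto
  moreover have "j = n"
    using less[of j n] j by (cases "j = n") auto
  ultimately show ?thesis
    using that[of "(!) xs" n] i j less Q by (auto simp: Q_def)
qed

text \<open>A partition through the points of both P and Q yields one sum that is close to both
  candidates.\<close>

lemma has_RS_integral_unique:
  assumes "has_RS_integral F g I" "has_RS_integral F g J"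
  shows "I = J"
proof (rule ccontr)
  assume "I \<noteq> J"
  define \<epsilon> where "\<epsilon> = \<bar>I - J\<bar> / 2"
  have "\<epsilon> > 0" using \<open>I \<noteq> J\<close> by (simp add: \<epsilon>_def)
  obtain P where finP: "finite P" and P: "\<forall>n. \<forall>t s :: nat \<Rightarrow> ereal.
       t 0 = - \<infinity> \<and> t n = \<infinity> \<and> (\<forall>i<n. t i < t (Suc i)) \<and> P \<subseteq> t ` {..n} \<and>
       (\<forall>i<n. t i \<le> s i \<and> s i \<le> t (Suc i)) \<longrightarrow>
       \<bar>(\<Sum>i<n. F (s i) * (g (t (Suc i)) - g (t i))) - I\<bar> < \<epsilon>"
    using assms(1) \<open>\<epsilon> > 0\<close> unfolding has_RS_integral_def by (elim allE[of _ \<epsilon>] impE exE conjE)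
  obtain Q where finQ: "finite Q" and Q: "\<forall>n. \<forall>t s :: nat \<Rightarrow> ereal.
       t 0 = - \<infinity> \<and> t n = \<infinity> \<and> (\<forall>i<n. t i < t (Suc i)) \<and> Q \<subseteq> t ` {..n} \<and>
       (\<forall>i<n. t i \<le> s i \<and> s i \<le> t (Suc i)) \<longrightarrow>
       \<bar>(\<Sum>i<n. F (s i) * (g (t (Suc i)) - g (t i))) - J\<bar> < \<epsilon>"
    using assms(2) \<open>\<epsilon> > 0\<close> unfolding has_RS_integral_def by (elim allE[of _ \<epsilon>] impE exE conjE)
  have "finite (P \<union> Q)" using finP finQ by simp
  then obtain n and t :: "nat \<Rightarrow> ereal" where t: "t 0 = - \<infinity>" "t n = \<infinity>" "\<forall>i<n. t i < t (Suc i)" "P \<union> Q \<subseteq> t ` {..n}"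
    by (rule partition_exists)
  \<comment> \<open>\<open>t\<close> is also passed as the tag sequence: left end points serve as
    tags.\<close>
  have "\<bar>(\<Sum>i<n. F (t i) * (g (t (Suc i)) - g (t i))) - I\<bar> < \<epsilon>"
    using t by (intro P[THEN spec[of _ n], THEN spec[of _ t], THEN spec[of _ t], THEN mp]) (auto intro: less_imp_le)
  moreover have "\<bar>(\<Sum>i<n. F (t i) * (g (t (Suc i)) - g (t i))) - J\<bar> < \<epsilon>"
    using t by (intro Q[THEN spec[of _ n], THEN spec[of _ t], THEN spec[of _ t], THEN mp]) (auto intro: less_imp_le)
  ultimately have "\<bar>I - J\<bar> < 2 * \<epsilon>" by linarith
  then show False by (simp add: \<epsilon>_def)
qed

lemma RS_integral_eqI: "has_RS_integral F g I \<Longrightarrow> RS_integral F g = I"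
  unfolding RS_integral_def using has_RS_integral_unique by blast

section \<open>The Cauchy-type integral\<close>

lemma cmod_of_real_diff_squared: "(cmod (of_real t - z))\<^sup>2 = (t - Re z)\<^sup>2 + (Im z)\<^sup>2"
  by (simp add: cmod_power2)

lemma Im_le_cmod_of_real_diff: "\<bar>Im z\<bar> \<le> cmod (of_real t - z)"
  using abs_Im_le_cmod[of "of_real t - z"] by simp

text \<open>The substitution s = (t - Re z) / y reduces this to 1 / (1 + s^2), up to the factor 1 /
  y^2.\<close>

lemma integrable_inverse_cmod_squared:
  assumes "Im z > 0"
  shows "integrable lborel (\<lambda>t. 1 / (cmod (of_real t - z))\<^sup>2)"
proof -
  define y where "y = Im z"
  have y: "y > 0" using assms by (simp add: y_def)
  have "integrable lborel (\<lambda>t. 1 / (1 + (- Re z / y + 1 / y * t)\<^sup>2))"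
  proof (rule lborel_integrable_real_affine)
    show "integrable lborel (\<lambda>x::real. 1 / (1 + x\<^sup>2))"
      using integrable_inverse_1_plus_square by (simp add: set_integrable_def inverse_eq_divide)
  qed (use y in simp)
  then have "integrable lborel (\<lambda>t. 1 / y\<^sup>2 * (1 / (1 + (- Re z / y + 1 / y * t)\<^sup>2)))"
    by (rule integrable_mult_right)
  also have "(\<lambda>t. 1 / y\<^sup>2 * (1 / (1 + (- Re z / y + 1 / y * t)\<^sup>2)))
      = (\<lambda>t. 1 / (cmod (of_real t - z))\<^sup>2)"
  proof
    fix t
    have "- Re z / y + 1 / y * t = (t - Re z) / y"
      by (simp add: diff_divide_distrib)
    then have "y\<^sup>2 * (1 + (- Re z / y + 1 / y * t)\<^sup>2) = (cmod (of_real t - z))\<^sup>2"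
      unfolding cmod_of_real_diff_squared y_def[symmetric]
      using y by (simp add: power_divide distrib_left)
    moreover have "1 / y\<^sup>2 * (1 / X) = 1 / (y\<^sup>2 * X)" for X
      by simp
    ultimately show "1 / y\<^sup>2 * (1 / (1 + (- Re z / y + 1 / y * t)\<^sup>2)) = 1 / (cmod (of_real t - z))\<^sup>2"
      by (simp only:)
  qed
  finally show ?thesis .
qed

lemma integrable_cauchy_kernel:
  fixes h :: "real \<Rightarrow> real"
  assumes [measurable]: "h \<in> borel_measurable borel" and B: "\<And>t. \<bar>h t\<bar> \<le> B" and "Im z > 0"
  shows "integrable lborel (\<lambda>t. of_real (h t) / (of_real t - z)\<^sup>2)"
proof (rule Bochner_Integration.integrable_bound)
  show "integrable lborel (\<lambda>t. B * (1 / (cmod (of_real t - z))\<^sup>2))"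
    by (intro integrable_mult_right integrable_inverse_cmod_squared assms)
  have "norm (of_real (h t) / (of_real t - z)\<^sup>2) \<le> norm (B * (1 / (cmod (of_real t - z))\<^sup>2))" for t
    using B[of t] by (auto simp: norm_divide norm_power intro!: divide_right_mono)
  then show "AE t in lborel. norm (of_real (h t) / (of_real t - z)\<^sup>2)
      \<le> norm (B * (1 / (cmod (of_real t - z))\<^sup>2))"
    by simp
qed measurable

text \<open>Formally 2 * pi * i times the derivative of the Cauchy integral of h. Unlike the Cauchy
  integral itself, it converges absolutely for every bounded measurable h when
  \<open>Im z > 0\<close>.\<close>

definition cauchy_square :: "(real \<Rightarrow> real) \<Rightarrow> complex \<Rightarrow> complex" where
  "cauchy_square h z = (\<integral>t. of_real (h t) / (of_real t - z)\<^sup>2 \<partial>lborel)"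

text \<open>Used with a = t - z and b = t - w, so a - b = w - z. The right side no longer contains
  the small denominator and can be dominated as w tends to z.\<close>

lemma inverse_square_difference_quotient:
  fixes a b :: complex
  assumes "a \<noteq> 0" "b \<noteq> 0" "a \<noteq> b"
  shows "(1 / b\<^sup>2 - 1 / a\<^sup>2) / (a - b) = 1 / (a * b\<^sup>2) + 1 / (a\<^sup>2 * b)"
proof -
  have "1 / b\<^sup>2 - 1 / a\<^sup>2 = (a - b) * (a + b) / (a\<^sup>2 * b\<^sup>2)"
    using assms by (simp add: field_simps power2_eq_square)
  then have "(1 / b\<^sup>2 - 1 / a\<^sup>2) / (a - b) = (a + b) / (a\<^sup>2 * b\<^sup>2)"
    using assms by simp
  also have "\<dots> = 1 / (a * b\<^sup>2) + 1 / (a\<^sup>2 * b)"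
    using assms by (simp add: add_divide_distrib power2_eq_square)
  finally show ?thesis .
qed

lemma holomorphic_cauchy_square:
  fixes h :: "real \<Rightarrow> real"
  assumes [measurable]: "h \<in> borel_measurable borel" and B: "\<And>t. \<bar>h t\<bar> \<le> B"
  shows "cauchy_square h holomorphic_on {z. Im z > 0}"
proof (rule holomorphic_onI)
  fix z assume "z \<in> {z. Im z > 0}"
  then have y: "Im z > 0" by simp
  define y where "y = Im z"
  \<comment> \<open>This is 2 * h(t) / (t - z)^3 under the integral, left unsimplified so that it is
    literally the limit of the difference quotients \<open>?q\<close>.\<close>
  define D where "D = (\<integral>t. of_real (h t) * (1 / ((of_real t - z) * (of_real t - z)\<^sup>2)
      + 1 / ((of_real t - z)\<^sup>2 * (of_real t - z))) \<partial>lborel)"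
  let ?S = "ball z (y / 2)"
  have nz: "of_real t - z \<noteq> 0" for t
    using y by (auto simp: complex_eq_iff)
  \<comment> \<open>Working within the ball confines the sequences to points where the estimates
    hold. The ball is open, so nothing is lost.\<close>
  have "(cauchy_square h has_field_derivative D) (at z within ?S)"
    unfolding has_field_derivative_iff tendsto_at_iff_sequentially
  proof (intro allI impI)
    fix w :: "nat \<Rightarrow> complex"
    assume wS: "\<forall>i. w i \<in> ?S - {z}" and lim: "w \<longlonglongrightarrow> z"
    \<comment> \<open>Moving z by less than y / 2 costs at most half of the distance to t, which is
      at least y.\<close>
    have half: "cmod (of_real t - z) / 2 \<le> cmod (of_real t - w i)" for i t
    proof -
      have "cmod (w i - z) < y / 2"
        using wS by (auto simp: dist_norm norm_minus_commute)
      moreover have "y \<le> cmod (of_real t - z)"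
        using Im_le_cmod_of_real_diff[of z t] y by (simp add: y_def)
      moreover have "cmod (of_real t - z) \<le> cmod (of_real t - w i) + cmod (w i - z)"
        using norm_triangle_ineq[of "of_real t - w i" "w i - z"] by simp
      ultimately show ?thesis by linarith
    qed
    have nw: "of_real t - w i \<noteq> 0" for t i
      using half[of t i] nz[of t] by auto
    have Imw: "Im (w i) > 0" for i
    proof -
      have "cmod (w i - z) < y / 2"
        using wS by (auto simp: dist_norm norm_minus_commute)
      then show ?thesis
        using abs_Im_le_cmod[of "w i - z"] y by (simp add: y_def)
    qed
    let ?q = "\<lambda>w t. of_real (h t) * (1 / ((of_real t - z) * (of_real t - w)\<^sup>2)
        + 1 / ((of_real t - z)\<^sup>2 * (of_real t - w))) :: complex"
    have "(cauchy_square h (w i) - cauchy_square h z) / (w i - z) = (\<integral>t. ?q (w i) t \<partial>lborel)" for i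
    proof -
      have "w i \<noteq> z" using wS by auto
      have "(cauchy_square h (w i) - cauchy_square h z) / (w i - z)
         = (\<integral>t. (of_real (h t) / (of_real t - w i)\<^sup>2 - of_real (h t) / (of_real t - z)\<^sup>2) / (w i - z) \<partial>lborel)"
        unfolding cauchy_square_def
        using integrable_cauchy_kernel[OF assms Imw[of i]] integrable_cauchy_kernel[OF assms y] by simp
      also have "\<dots> = (\<integral>t. ?q (w i) t \<partial>lborel)"
      proof (rule Bochner_Integration.integral_cong)
        fix t
        have "(of_real (h t) / (of_real t - w i)\<^sup>2 - of_real (h t) / (of_real t - z)\<^sup>2) / (w i - z)
          = of_real (h t) * ((1 / (of_real t - w i)\<^sup>2 - 1 / (of_real t - z)\<^sup>2) / ((of_real t - z) - (of_real t - w i)))"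
          by (simp add: right_diff_distrib)
        also have "\<dots> = ?q (w i) t"
          using nz nw \<open>w i \<noteq> z\<close> by (subst inverse_square_difference_quotient) auto
        finally show "(of_real (h t) / (of_real t - w i)\<^sup>2 - of_real (h t) / (of_real t - z)\<^sup>2) / (w i - z)
          = ?q (w i) t" .
      qed simp
      finally show ?thesis .
    qed
    moreover have "(\<lambda>i. \<integral>t. ?q (w i) t \<partial>lborel) \<longlonglongrightarrow> D"
      unfolding D_def
    proof (rule integral_dominated_convergence)
      \<comment> \<open>Replacing b by its lower bound a / 2 turns the two terms into 4 / a^3 + 2 /
        a^3. One factor 1 / a is then bounded by 1 / y.\<close>
      show "integrable lborel (\<lambda>t. 6 * B / y * (1 / (cmod (of_real t - z))\<^sup>2))"
        by (intro integrable_mult_right integrable_inverse_cmod_squared y)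
      have "(\<lambda>i. ?q (w i) t) \<longlonglongrightarrow> ?q z t" for t
        by (intro tendsto_intros lim) (use nz in auto)
      then show "AE t in lborel. (\<lambda>i. ?q (w i) t) \<longlonglongrightarrow> ?q z t" by simp
      have "norm (?q (w i) t) \<le> 6 * B / y * (1 / (cmod (of_real t - z))\<^sup>2)" for i t
      proof -
        define a b where "a = cmod (of_real t - z)" and "b = cmod (of_real t - w i)"
        have ab: "a / 2 \<le> b" "y \<le> a" "y > 0"
          using half[of t i] Im_le_cmod_of_real_diff[of z t] y by (auto simp: a_def b_def y_def)
        then have "a > 0" "b > 0" by auto
        have "norm (1 / ((of_real t - z) * (of_real t - w i)\<^sup>2)
            + 1 / ((of_real t - z)\<^sup>2 * (of_real t - w i))) \<le> 1 / (a * b\<^sup>2) + 1 / (a\<^sup>2 * b)"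
          by (rule order.trans[OF norm_triangle_ineq])
            (simp add: norm_divide norm_mult norm_power a_def b_def)
        then have "norm (?q (w i) t) \<le> \<bar>h t\<bar> * (1 / (a * b\<^sup>2) + 1 / (a\<^sup>2 * b))"
          unfolding norm_mult norm_of_real by (rule mult_left_mono) simp
        also have "\<dots> \<le> B * (1 / (a * (a / 2)\<^sup>2) + 1 / (a\<^sup>2 * (a / 2)))"
        proof (intro mult_mono add_mono B)
          have "(a / 2)\<^sup>2 \<le> b\<^sup>2"
            using ab \<open>a > 0\<close> by (intro power_mono) auto
          then have "a * (a / 2)\<^sup>2 \<le> a * b\<^sup>2"
            using \<open>a > 0\<close> by simp
          then show "1 / (a * b\<^sup>2) \<le> 1 / (a * (a / 2)\<^sup>2)"
            using \<open>a > 0\<close> \<open>b > 0\<close> by (intro divide_left_mono) auto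
          have "a\<^sup>2 * (a / 2) \<le> a\<^sup>2 * b"
            using ab \<open>a > 0\<close> by (intro mult_left_mono) auto
          then show "1 / (a\<^sup>2 * b) \<le> 1 / (a\<^sup>2 * (a / 2))"
            using \<open>a > 0\<close> \<open>b > 0\<close> by (intro divide_left_mono) auto
        qed (use \<open>a > 0\<close> \<open>b > 0\<close> B[of t] in auto)
        also have "\<dots> = 6 * B / a * (1 / a\<^sup>2)"
          using \<open>a > 0\<close> by (simp add: field_simps power2_eq_square)
        also have "\<dots> \<le> 6 * B / y * (1 / a\<^sup>2)"
          using ab B[of t] by (intro mult_right_mono divide_left_mono) auto
        finally show ?thesis by (simp add: a_def)
      qed
      then show "AE t in lborel. norm (?q (w i) t) \<le> 6 * B / y * (1 / (cmod (of_real t - z))\<^sup>2)" for i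
        by simp
    qed measurable
    ultimately show "((\<lambda>w. (cauchy_square h w - cauchy_square h z) / (w - z)) \<circ> w) \<longlonglongrightarrow> D"
      by (simp add: comp_def)
  qed
  then have "(cauchy_square h has_field_derivative D) (at z)"
    using y by (subst (asm) at_within_open) (auto simp: y_def)
  then show "cauchy_square h field_differentiable (at z within {z. Im z > 0})"
    using field_differentiable_at_within field_differentiable_def by blast
qed

section \<open>Imaginary parts of holomorphic functions\<close>

definition complex_of_pair :: "real \<times> real \<Rightarrow> complex" where
  "complex_of_pair z = Complex (fst z) (snd z)"

lemma complex_of_pair_line:
  "complex_of_pair (z + s *\<^sub>R b) = complex_of_pair z + of_real s * complex_of_pair b"
  by (simp add: complex_of_pair_def complex_eq_iff)

lemma continuous_complex_of_pair: "continuous_on S complex_of_pair"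
  unfolding complex_of_pair_def Complex_eq by (intro continuous_intros)

context
  fixes S :: "(real \<times> real) set" and H :: "complex set"
  assumes open_S: "open S" and open_H: "open H" and maps: "complex_of_pair ` S \<subseteq> H"
begin

text \<open>The chain rule along the line through z in direction b. Agreement of u with Im G is
  assumed on S only, so that the lemma applies again to \<open>partial b u\<close>, whose formula is
  known only there.\<close>

lemma Im_holomorphic_has_partial:
  assumes G: "G holomorphic_on H" and u: "\<And>z. z \<in> S \<Longrightarrow> u z = Im (G (complex_of_pair z))" and "z \<in> S"
  shows "((\<lambda>s. u (z + s *\<^sub>R b)) has_real_derivative
      Im (deriv G (complex_of_pair z) * complex_of_pair b)) (at 0)"
proof -
  let ?c = "complex_of_pair z" and ?d = "complex_of_pair b"
  have "(G has_field_derivative deriv G ?c) (at ?c)"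
    using G open_H maps \<open>z \<in> S\<close> by (intro holomorphic_derivI) auto
  then have "((\<lambda>w. G (?c + w * ?d)) has_field_derivative deriv G ?c * ?d) (at (of_real 0))"
    by (intro DERIV_chain2[where f = G]) (auto intro!: derivative_eq_intros)
  then have "((\<lambda>s. G (?c + of_real s * ?d)) has_vector_derivative deriv G ?c * ?d) (at 0)"
    by (rule has_vector_derivative_real_field)
  then have "((\<lambda>s. Im (G (?c + of_real s * ?d))) has_real_derivative Im (deriv G ?c * ?d)) (at 0)"
    unfolding has_real_derivative_iff_has_vector_derivative
    by (rule bounded_linear.has_vector_derivative[OF bounded_linear_Im])
  moreover have "\<forall>\<^sub>F s in nhds 0. u (z + s *\<^sub>R b) = Im (G (?c + of_real s * ?d))"
  proof -
    have "continuous_on UNIV (\<lambda>s::real. z + s *\<^sub>R b)"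
      by (intro continuous_intros)
    then have "open ((\<lambda>s::real. z + s *\<^sub>R b) -` S)"
      using open_S by (simp add: open_vimage)
    then have "\<forall>\<^sub>F s in nhds 0. s \<in> (\<lambda>s::real. z + s *\<^sub>R b) -` S"
      using \<open>z \<in> S\<close> by (intro eventually_nhds_in_open) auto
    then show ?thesis
      by eventually_elim (simp add: u complex_of_pair_line)
  qed
  ultimately show ?thesis
    by (subst DERIV_cong_ev[OF refl _ refl])
qed

lemma Im_holomorphic_partial:
  assumes "G holomorphic_on H" "\<And>z. z \<in> S \<Longrightarrow> u z = Im (G (complex_of_pair z))" "z \<in> S"
  shows "partial b u z = Im (deriv G (complex_of_pair z) * complex_of_pair b)"
  unfolding partial_def by (rule DERIV_imp_deriv[OF Im_holomorphic_has_partial[OF assms]])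

lemma holomorphic_directional:
  "G holomorphic_on H \<Longrightarrow> (\<lambda>w. deriv G w * c) holomorphic_on H"
  by (intro holomorphic_intros holomorphic_deriv open_H)

lemma Im_holomorphic_C1_on:
  assumes G: "G holomorphic_on H" "\<And>z. z \<in> S \<Longrightarrow> u z = Im (G (complex_of_pair z))"
  shows "C1_on S u"
  unfolding C1_on_def
proof (intro ballI conjI)
  fix b :: "real \<times> real"
  show "(\<lambda>s. u (z + s *\<^sub>R b)) field_differentiable (at 0)" if "z \<in> S" for z
    using Im_holomorphic_has_partial[OF G that] field_differentiable_def by blast
  have "continuous_on S ((\<lambda>w. deriv G w * complex_of_pair b) \<circ> complex_of_pair)"
    by (intro continuous_on_compose continuous_complex_of_pair
        continuous_on_subset[OF holomorphic_on_imp_continuous_on[OF holomorphic_directional[OF G(1)]] maps])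
  then have "continuous_on S (\<lambda>z. Im (deriv G (complex_of_pair z) * complex_of_pair b))"
    unfolding comp_def by (rule continuous_on_Im)
  then show "continuous_on S (partial b u)"
    by (simp add: Im_holomorphic_partial[OF G] cong: continuous_on_cong)
qed

text \<open>Each partial derivative is again the imaginary part of a holomorphic function, so the
  first-order result can be applied twice.\<close>

lemma Im_holomorphic_harmonic_on:
  assumes G: "G holomorphic_on H" "\<And>z. z \<in> S \<Longrightarrow> u z = Im (G (complex_of_pair z))"
  shows "harmonic_on S u"
  unfolding harmonic_on_def C2_on_def
proof (intro conjI ballI)
  note partial = Im_holomorphic_partial[OF G]
  note G' = holomorphic_directional[OF G(1)]
  show "open S" by (rule open_S)
  show "C1_on S u" by (rule Im_holomorphic_C1_on[OF G])
  show "C1_on S (partial b u)" for b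
    by (rule Im_holomorphic_C1_on[OF G' partial])
  fix z assume z: "z \<in> S"
  let ?d = "deriv (deriv G) (complex_of_pair z)"
  have "partial b (partial b u) z = Im (?d * (complex_of_pair b)\<^sup>2)" for b
  proof -
    have "deriv G field_differentiable (at (complex_of_pair z))"
      using holomorphic_deriv[OF G(1) open_H] maps z open_H holomorphic_on_imp_differentiable_at
      by blast
    then show ?thesis
      by (subst Im_holomorphic_partial[OF G' partial z])
        (simp_all add: deriv_cmult_right power2_eq_square mult.assoc)
  qed
  \<comment> \<open>The basis vectors become 1 and i, and 1 + i^2 = 0. This is the Laplace
    equation.\<close>
  moreover have "(\<Sum>b\<in>Basis. (complex_of_pair b)\<^sup>2) = 0"
    by (simp add: Basis_prod_def sum.union_disjoint complex_of_pair_def complex_eq_iff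
        power2_eq_square)
  ultimately show "(\<Sum>b\<in>Basis. partial b (partial b u) z) = 0"
    by (simp only: Im_sum[symmetric] sum_distrib_left[symmetric]) simp
qed

end

section \<open>The Poisson integral as an imaginary part\<close>

lemma bounded_of_limits:
  fixes h :: "real \<Rightarrow> real"
  assumes h: "continuous_on UNIV h" "(h \<longlongrightarrow> L) at_top" "(h \<longlongrightarrow> M) at_bot"
  obtains B where "\<And>x. \<bar>h x\<bar> \<le> B"
proof -
  obtain b where b: "\<And>x. x \<ge> b \<Longrightarrow> \<bar>h x - L\<bar> < 1"
    using tendstoD[OF h(2), of 1] by (auto simp: dist_real_def eventually_at_top_linorder)
  obtain a where a: "\<And>x. x \<le> a \<Longrightarrow> \<bar>h x - M\<bar> < 1"
    using tendstoD[OF h(3), of 1] by (auto simp: dist_real_def eventually_at_bot_linorder)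
  have "bounded (h ` {a..b})"
    by (intro compact_imp_bounded compact_continuous_image continuous_on_subset[OF h(1)]) auto
  then obtain C where C: "\<And>x. x \<in> {a..b} \<Longrightarrow> \<bar>h x\<bar> \<le> C"
    unfolding bounded_iff by (auto simp del: atLeastAtMost_iff)
  have "\<bar>h x\<bar> \<le> \<bar>C\<bar> + \<bar>L\<bar> + \<bar>M\<bar> + 1" for x
  proof -
    consider "x \<le> a" | "x \<ge> b" | "x \<in> {a..b}" by fastforce
    then show ?thesis
      by cases (use a[of x] b[of x] C[of x] in linarith)+
  qed
  then show ?thesis by (rule that)
qed

lemma poisson_kernel_eq_Im:
  "poisson_kernel (x - t) y = Im (1 / (of_real t - Complex x y)) / pi"
  by (simp add: poisson_kernel_def Im_divide power2_eq_square field_simps)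

lemma integrator_poisson_kernel:
  assumes "Im z > 0"
  shows "integrator (\<lambda>t. Im (1 / (of_real t - z)) / pi) (\<lambda>t. - Im (1 / (of_real t - z)\<^sup>2) / pi) 0 0"
proof
  have nz: "of_real t - z \<noteq> 0" for t
    using assms by (auto simp: complex_eq_iff)
  show "((\<lambda>t. Im (1 / (of_real t - z)) / pi) has_real_derivative - Im (1 / (of_real t - z)\<^sup>2) / pi) (at t)" for t
  proof -
    have "((\<lambda>w. 1 / (w - z)) has_field_derivative - (1 / (of_real t - z)\<^sup>2)) (at (of_real t))"
      using nz[of t] by (auto intro!: derivative_eq_intros simp: power2_eq_square)
    then have "((\<lambda>t. 1 / (of_real t - z)) has_vector_derivative - (1 / (of_real t - z)\<^sup>2)) (at t)"
      by (rule has_vector_derivative_real_field)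
    then have "((\<lambda>t. Im (1 / (of_real t - z))) has_real_derivative Im (- (1 / (of_real t - z)\<^sup>2))) (at t)"
      unfolding has_real_derivative_iff_has_vector_derivative
      by (rule bounded_linear.has_vector_derivative[OF bounded_linear_Im])
    then have "((\<lambda>t. Im (1 / (of_real t - z))) has_real_derivative - Im (1 / (of_real t - z)\<^sup>2)) (at t)"
      by (simp only: uminus_complex.sel)
    then show ?thesis
      by (rule DERIV_cdivide)
  qed
  show "continuous_on UNIV (\<lambda>t. - Im (1 / (of_real t - z)\<^sup>2) / pi)"
    using nz by (intro continuous_intros) auto
  \<comment> \<open>The case of the constant function h = 1.\<close>
  have "integrable lborel (\<lambda>t. of_real 1 / (of_real t - z)\<^sup>2)"
    by (rule integrable_cauchy_kernel[where B = 1]) (use assms in auto)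
  then have "integrable lborel (\<lambda>t. Im (1 / (of_real t - z)\<^sup>2))"
    unfolding of_real_1 by (rule integrable_Im)
  then show "integrable lborel (\<lambda>t. - Im (1 / (of_real t - z)\<^sup>2) / pi)"
    by (intro integrable_divide Bochner_Integration.integrable_minus)
  \<comment> \<open>On the line \<open>at_infinity\<close> covers both ends, so one limit serves
    \<open>at_top\<close> and \<open>at_bot\<close>.\<close>
  have "filterlim (\<lambda>t::real. of_real t :: complex) at_infinity at_infinity"
    by (simp add: filterlim_at_infinity_conv_norm_at_top filterlim_norm_at_top[where 'a = real, unfolded real_norm_def])
  then have "filterlim (\<lambda>t. - z + of_real t) at_infinity (at_infinity :: real filter)"
    by (rule tendsto_add_filterlim_at_infinity[OF tendsto_const])
  then have "((\<lambda>t::real. inverse (- z + of_real t)) \<longlongrightarrow> 0) at_infinity"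
    by (rule filterlim_compose[OF tendsto_inverse_0])
  then have "((\<lambda>t::real. Im (1 / (of_real t - z)) / pi) \<longlongrightarrow> Im 0 / pi) at_infinity"
    by (intro tendsto_intros) (auto simp: inverse_eq_divide)
  then have lim: "((\<lambda>t::real. Im (1 / (of_real t - z)) / pi) \<longlongrightarrow> 0) at_infinity"
    by simp
  show "((\<lambda>t::real. Im (1 / (of_real t - z)) / pi) \<longlongrightarrow> 0) at_top"
    by (rule tendsto_mono[OF at_top_le_at_infinity lim])
  show "((\<lambda>t::real. Im (1 / (of_real t - z)) / pi) \<longlongrightarrow> 0) at_bot"
    by (rule tendsto_mono[OF at_bot_le_at_infinity lim])
qed

lemma poisson_integral_eq_Im:
  assumes f: "f \<in> A_C" and F: "primitive f = extend h"
    and h: "continuous_on UNIV h" "(h \<longlongrightarrow> L) at_top" "(h \<longlongrightarrow> M) at_bot" and "y > 0"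
  shows "cp_integrable f (extend (\<lambda>t. poisson_kernel (x - t) y))"
    and "poisson_integral f x y = Im (cauchy_square h (Complex x y) / of_real pi)"
proof -
  define z where "z = Complex x y"
  have "Im z > 0" using \<open>y > 0\<close> by (simp add: z_def)
  interpret integrator "\<lambda>t. Im (1 / (of_real t - z)) / pi" "\<lambda>t. - Im (1 / (of_real t - z)\<^sup>2) / pi" 0 0
    by (rule integrator_poisson_kernel[OF \<open>Im z > 0\<close>])
  let ?k = "\<lambda>t. Im (1 / (of_real t - z)) / pi" and ?k' = "\<lambda>t. - Im (1 / (of_real t - z)\<^sup>2) / pi"
  have kernel: "(\<lambda>t. poisson_kernel (x - t) y) = ?k"
    by (simp only: poisson_kernel_eq_Im z_def)
  obtain B where B: "\<And>t. \<bar>h t\<bar> \<le> B"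
    using bounded_of_limits[OF h] by blast
  have [measurable]: "h \<in> borel_measurable borel"
    by (rule borel_measurable_continuous_onI[OF h(1)])
  have int: "integrable lborel (\<lambda>t. of_real (h t) / (of_real t - z)\<^sup>2)"
    by (rule integrable_cauchy_kernel[OF _ B \<open>Im z > 0\<close>]) measurable
  have hk: "h t * ?k' t = - (Im (of_real (h t) / (of_real t - z)\<^sup>2) / pi)" for t
  proof -
    have "of_real (h t) / (of_real t - z)\<^sup>2 = of_real (h t) * (1 / (of_real t - z)\<^sup>2)"
      by simp
    moreover have "Im (of_real a * w) = a * Im w" for a w
      by simp
    ultimately have "Im (of_real (h t) / (of_real t - z)\<^sup>2) = h t * Im (1 / (of_real t - z)\<^sup>2)"
      by (simp only:)
    then show ?thesis by simp
  qed
  have "integrable lborel (\<lambda>t. h t * ?k' t)"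
    unfolding hk using integrable_Im[OF int]
    by (intro integrable_divide Bochner_Integration.integrable_minus)
  then have RS: "has_RS_integral (primitive f) (extend ?k) (\<integral>t. h t * ?k' t \<partial>lborel)"
    unfolding F by (rule has_RS_integral[OF h])
  then show "cp_integrable f (extend (\<lambda>t. poisson_kernel (x - t) y))"
    unfolding cp_integrable_def kernel using f bounded_variation by blast
  \<comment> \<open>This minus sign cancels the one in front of \<open>RS_integral\<close> in
    \<open>cp_integral\<close>. The boundary term vanishes because the kernel tends to 0 at
    infinity.\<close>
  have "(\<integral>t. h t * ?k' t \<partial>lborel) = - (Im (cauchy_square h z) / pi)"
    unfolding hk cauchy_square_def using int by simp
  then show "poisson_integral f x y = Im (cauchy_square h (Complex x y) / of_real pi)"
    unfolding poisson_integral_def cp_integral_def kernel RS_integral_eqI[OF RS] extend_infinity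
    by (simp add: z_def)
qed

theorem mainTheorem11:
  fixes f :: functional
  assumes "f \<in> A_C"
  shows "(\<forall>x y. y > 0 \<longrightarrow> cp_integrable f (extend (\<lambda>t. poisson_kernel (x - t) y))) \<and>
         harmonic_on {(x :: real, y :: real). y > 0} (\<lambda>(x, y). poisson_integral f x y)"
proof -
  obtain F where "is_primitive F f"
    using assms by (auto simp: A_C_def)
  then have "primitive f = F" "F \<in> B_C"
    by (simp_all add: primitive_eqI is_primitive_def)
  then obtain h L where F: "primitive f = extend h"
    and h: "continuous_on UNIV h" "(h \<longlongrightarrow> L) at_top" "(h \<longlongrightarrow> 0) at_bot"
    using B_C_cases by metis
  note poisson = poisson_integral_eq_Im[OF assms F h]
  obtain B where B: "\<And>t. \<bar>h t\<bar> \<le> B"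
    using bounded_of_limits[OF h] by blast
  have upper: "{(x :: real, y :: real). y > 0} = UNIV \<times> {0<..}"
    by auto
  have "harmonic_on {(x :: real, y :: real). y > 0} (\<lambda>(x, y). poisson_integral f x y)"
  proof (rule Im_holomorphic_harmonic_on)
    show "open {(x :: real, y :: real). y > 0}"
      unfolding upper by (intro open_Times) auto
    show "open {z. Im z > 0}"
      by (rule open_halfspace_Im_gt)
    show "complex_of_pair ` {(x, y). y > 0} \<subseteq> {z. Im z > 0}"
      by (auto simp: complex_of_pair_def)
    show "(\<lambda>z. cauchy_square h z / of_real pi) holomorphic_on {z. Im z > 0}"
      using borel_measurable_continuous_onI[OF h(1)] B
      by (intro holomorphic_intros holomorphic_cauchy_square) auto
    show "(\<lambda>(x, y). poisson_integral f x y) z = Im (cauchy_square h (complex_of_pair z) / of_real pi)"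
      if "z \<in> {(x, y). y > 0}" for z
      using that by (auto simp: complex_of_pair_def poisson(2))
  qed
  then show ?thesis
    using poisson(1) by blast
qed

end
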